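(* The Thompson group $V$ is isomorphic to a subgroup of the multiplicative part of the Cuntz–Dixmier $C^\star$-algebra $\mathcal O_2$. More generally, for every integer $n\ge 2$, the Thompson–Higman group $G_{n,1}$ is isomorphic to a subgroup of the multiplicative part of the Cuntz $C^\star$-algebra $\mathcal O_n$.
   Context: The Cuntz algebra $\mathcal O_n$ ($n\ge2$) is the universal unital $C^\star$-algebra generated by elements $s_1,\dots,s_n$ with $s_i^\star s_i=\mathbf 1$, $s_i^\star s_j=0$ for $i\ne j$, and $\sum_{i=1}^n s_is_i^\star=\mathbf 1$. Its multiplicative part is the monoid given by its multiplication. Let $A$ be an alphabet with $n\geq 2$ letters, $A^*$ the free monoid on $A$. A right ideal of $A^*$ is a subset $R$ with $RA^*\subseteq R$; it is essential if it meets every (non-empty) right ideal, and finitely generated if $R=PA^*$ with $P$ finite. A right-ideal isomorphism is a bijection $\varphi:R_1\to R_2$ between right ideals with $\varphi(ux)=\varphi(u)x$ for $u\in R_1$, $x\in A^*$. Every isomorphism $\varphi$ between essential right ideals has a unique maximum extension $\mathsf{max}\,\varphi$ to a right-ideal isomorphism. $G_{n,1}$ is the group of all maximal isomorphisms between finitely generated essential right ideals of $A^*$, with multiplication $\varphi\cdot\psi=\mathsf{max}(\varphi\circ\psi)$. $V=G_{2,1}$ (with $A=\{a,b\}$). *)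

theory Defs
  imports Complex_Main "HOL-Algebra.Module"
begin

section \<open>Unital C*-algebras\<close>

definition complex_ring :: "complex ring" where
  "complex_ring = \<lparr>carrier = UNIV, mult = (*), one = 1, zero = 0, add = (+)\<rparr>"

record 'a cstar = "(complex, 'a) module" +
  star :: "'a \<Rightarrow> 'a" (\<open>adj\<index> _\<close> [81] 80)
  cnorm :: "'a \<Rightarrow> real" (\<open>\<parallel>_\<parallel>\<index>\<close>)

(* The zero algebra is not excluded. *)
locale unital_cstar_algebra = Module.module complex_ring M + ring M for M (structure) +
  assumes smult_mult_left:
      "\<lbrakk>x \<in> carrier M; y \<in> carrier M\<rbrakk> \<Longrightarrow> (c \<odot> x) \<otimes> y = c \<odot> (x \<otimes> y)"
    and smult_mult_right:
      "\<lbrakk>x \<in> carrier M; y \<in> carrier M\<rbrakk> \<Longrightarrow> x \<otimes> (c \<odot> y) = c \<odot> (x \<otimes> y)"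
    and adj_closed: "x \<in> carrier M \<Longrightarrow> adj x \<in> carrier M"
    and adj_adj: "x \<in> carrier M \<Longrightarrow> adj (adj x) = x"
    and adj_add: "\<lbrakk>x \<in> carrier M; y \<in> carrier M\<rbrakk> \<Longrightarrow> adj (x \<oplus> y) = adj x \<oplus> adj y"
    and adj_smult: "x \<in> carrier M \<Longrightarrow> adj (c \<odot> x) = cnj c \<odot> adj x"
    and adj_mult: "\<lbrakk>x \<in> carrier M; y \<in> carrier M\<rbrakk> \<Longrightarrow> adj (x \<otimes> y) = adj y \<otimes> adj x"
    and cnorm_nonneg: "x \<in> carrier M \<Longrightarrow> \<parallel>x\<parallel> \<ge> 0"
    and cnorm_eq_0_iff: "x \<in> carrier M \<Longrightarrow> \<parallel>x\<parallel> = 0 \<longleftrightarrow> x = \<zero>"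
    and cnorm_smult: "x \<in> carrier M \<Longrightarrow> \<parallel>c \<odot> x\<parallel> = cmod c * \<parallel>x\<parallel>"
    and cnorm_triangle: "\<lbrakk>x \<in> carrier M; y \<in> carrier M\<rbrakk> \<Longrightarrow> \<parallel>x \<oplus> y\<parallel> \<le> \<parallel>x\<parallel> + \<parallel>y\<parallel>"
    and cnorm_mult: "\<lbrakk>x \<in> carrier M; y \<in> carrier M\<rbrakk> \<Longrightarrow> \<parallel>x \<otimes> y\<parallel> \<le> \<parallel>x\<parallel> * \<parallel>y\<parallel>"
    and cstar_identity: "x \<in> carrier M \<Longrightarrow> \<parallel>adj x \<otimes> x\<parallel> = \<parallel>x\<parallel>\<^sup>2"
    and complete:
      "\<lbrakk>\<And>k :: nat. f k \<in> carrier M;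
        \<And>e. e > 0 \<Longrightarrow> \<exists>N. \<forall>j\<ge>N. \<forall>k\<ge>N. \<parallel>f j \<ominus> f k\<parallel> < e\<rbrakk>
       \<Longrightarrow> \<exists>x\<in>carrier M. (\<lambda>k. \<parallel>f k \<ominus> x\<parallel>) \<longlonglongrightarrow> 0"

definition unital_star_hom :: "'a cstar \<Rightarrow> 'b cstar \<Rightarrow> ('a \<Rightarrow> 'b) set" where
  "unital_star_hom M N =
     {h \<in> ring_hom M N. \<forall>x\<in>carrier M.
        (\<forall>c. h (c \<odot>\<^bsub>M\<^esub> x) = c \<odot>\<^bsub>N\<^esub> h x) \<and> h (adj\<^bsub>M\<^esub> x) = adj\<^bsub>N\<^esub> (h x)}"

definition unital_cstar_subalgebra :: "'a set \<Rightarrow> 'a cstar \<Rightarrow> bool" where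
  "unital_cstar_subalgebra D M \<longleftrightarrow>
     D \<subseteq> carrier M \<and> \<one>\<^bsub>M\<^esub> \<in> D \<and>
     (\<forall>x\<in>D. \<forall>y\<in>D. x \<oplus>\<^bsub>M\<^esub> y \<in> D \<and> x \<otimes>\<^bsub>M\<^esub> y \<in> D) \<and>
     (\<forall>x\<in>D. (\<forall>c. c \<odot>\<^bsub>M\<^esub> x \<in> D) \<and> adj\<^bsub>M\<^esub> x \<in> D) \<and>
     (\<forall>f x. (\<forall>k :: nat. f k \<in> D) \<and> x \<in> carrier M \<and> (\<lambda>k. \<parallel>f k \<ominus>\<^bsub>M\<^esub> x\<parallel>\<^bsub>M\<^esub>) \<longlonglongrightarrow> 0 \<longrightarrow> x \<in> D)"

definition generated_by :: "'a cstar \<Rightarrow> 'a set \<Rightarrow> bool" where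
  "generated_by M S \<longleftrightarrow>
     S \<subseteq> carrier M \<and> (\<forall>D. unital_cstar_subalgebra D M \<and> S \<subseteq> D \<longrightarrow> D = carrier M)"

section \<open>The Cuntz algebra\<close>

definition cuntz_family :: "nat \<Rightarrow> 'a cstar \<Rightarrow> (nat \<Rightarrow> 'a) \<Rightarrow> bool" where
  "cuntz_family n M s \<longleftrightarrow>
     s ` {1..n} \<subseteq> carrier M \<and>
     (\<forall>i\<in>{1..n}. adj\<^bsub>M\<^esub> (s i) \<otimes>\<^bsub>M\<^esub> s i = \<one>\<^bsub>M\<^esub>) \<and>
     (\<forall>i\<in>{1..n}. \<forall>j\<in>{1..n}. i \<noteq> j \<longrightarrow> adj\<^bsub>M\<^esub> (s i) \<otimes>\<^bsub>M\<^esub> s j = \<zero>\<^bsub>M\<^esub>) \<and>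
     (\<Oplus>\<^bsub>M\<^esub>i\<in>{1..n}. s i \<otimes>\<^bsub>M\<^esub> adj\<^bsub>M\<^esub> (s i)) = \<one>\<^bsub>M\<^esub>"

(* \<open>cuntz_algebra n M s\<close>: M is the Cuntz algebra on the generators s 1, ..., s n, given by its
   universal property, which determines it up to isomorphism. The type of the test algebras B
   must be fixed, since types cannot be quantified. The type chosen is that of the operators on
   complex sequences, and it loses nothing: the C*-algebra generated by a Cuntz family in an
   arbitrary C*-algebra is separable, hence is faithfully represented on the Hilbert space of
   square-summable sequences, and so has a copy over this type. Uniqueness of h on the carrier
   follows from \<open>generated_by\<close>, since *-homomorphisms are contractive. *)
definition cuntz_algebra :: "nat \<Rightarrow> 'a cstar \<Rightarrow> (nat \<Rightarrow> 'a) \<Rightarrow> bool" where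
  "cuntz_algebra n M s \<longleftrightarrow>
     unital_cstar_algebra M \<and> cuntz_family n M s \<and> generated_by M (s ` {1..n}) \<and>
     (\<forall>(B :: ((nat \<Rightarrow> complex) \<Rightarrow> (nat \<Rightarrow> complex)) cstar) t.
        unital_cstar_algebra B \<and> cuntz_family n B t \<longrightarrow>
        (\<exists>h \<in> unital_star_hom M B. \<forall>i\<in>{1..n}. h (s i) = t i))"

definition multiplicative_part :: "'a cstar \<Rightarrow> 'a monoid" where
  "multiplicative_part M = \<lparr>carrier = carrier M, mult = mult M, one = one M\<rparr>"

(* The identity of the subgroup is the identity of the monoid. *)
definition subgroup_of_monoid :: "'a set \<Rightarrow> 'a monoid \<Rightarrow> bool" where
  "subgroup_of_monoid H M \<longleftrightarrow> submonoid H M \<and> group (M\<lparr>carrier := H\<rparr>)"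

section \<open>The Thompson--Higman groups\<close>

definition right_ideal :: "'a set \<Rightarrow> 'a list set \<Rightarrow> bool" where
  "right_ideal A R \<longleftrightarrow> R \<subseteq> lists A \<and> (\<forall>u\<in>R. \<forall>x\<in>lists A. u @ x \<in> R)"

definition essential :: "'a set \<Rightarrow> 'a list set \<Rightarrow> bool" where
  "essential A R \<longleftrightarrow> right_ideal A R \<and> (\<forall>S. right_ideal A S \<and> S \<noteq> {} \<longrightarrow> R \<inter> S \<noteq> {})"

definition finitely_generated :: "'a set \<Rightarrow> 'a list set \<Rightarrow> bool" where
  "finitely_generated A R \<longleftrightarrow>
     (\<exists>P. finite P \<and> P \<subseteq> lists A \<and> R = {p @ x |p x. p \<in> P \<and> x \<in> lists A})"

(* An isomorphism from R1 to R2 is a partial map with domain R1 and range R2. *)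
definition right_ideal_iso :: "'a set \<Rightarrow> ('a list \<rightharpoonup> 'a list) \<Rightarrow> bool" where
  "right_ideal_iso A \<phi> \<longleftrightarrow>
     right_ideal A (dom \<phi>) \<and> right_ideal A (ran \<phi>) \<and> inj_on \<phi> (dom \<phi>) \<and>
     (\<forall>u\<in>dom \<phi>. \<forall>x\<in>lists A. \<phi> (u @ x) = Some (the (\<phi> u) @ x))"

definition max_ext :: "'a set \<Rightarrow> ('a list \<rightharpoonup> 'a list) \<Rightarrow> ('a list \<rightharpoonup> 'a list)" where
  "max_ext A \<phi> =
     (THE \<psi>. right_ideal_iso A \<psi> \<and> \<phi> \<subseteq>\<^sub>m \<psi> \<and>
        (\<forall>\<chi>. right_ideal_iso A \<chi> \<and> \<phi> \<subseteq>\<^sub>m \<chi> \<longrightarrow> \<chi> \<subseteq>\<^sub>m \<psi>))"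

(* The group G_{n,1} over an alphabet A with n letters; maps act on the left, so that
   \<open>\<phi> \<circ>\<^sub>m \<psi>\<close> applies \<open>\<psi>\<close> first. *)
definition thompson_higman :: "'a set \<Rightarrow> ('a list \<rightharpoonup> 'a list) monoid" where
  "thompson_higman A =
     \<lparr>carrier = {\<phi>. right_ideal_iso A \<phi> \<and>
         essential A (dom \<phi>) \<and> finitely_generated A (dom \<phi>) \<and>
         essential A (ran \<phi>) \<and> finitely_generated A (ran \<phi>) \<and>
         (\<forall>\<psi>. right_ideal_iso A \<psi> \<and> \<phi> \<subseteq>\<^sub>m \<psi> \<longrightarrow> \<psi> = \<phi>)},
      mult = (\<lambda>\<phi> \<psi>. max_ext A (\<phi> \<circ>\<^sub>m \<psi>)),
      one = Some |` lists A\<rparr>"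

datatype letter = Letter_a | Letter_b

definition thompson_V :: "(letter list \<rightharpoonup> letter list) monoid" where
  "thompson_V = thompson_higman {Letter_a, Letter_b}"

end

theory Submission
  imports Defs "HOL-Analysis.L2_Norm" "HOL-Library.Function_Algebras"
begin

text \<open>Write \<open>s\<^sub>w\<close> for the product of the generators along a word \<open>w\<close>. An essential finitely generated right
  ideal is a right ideal containing all sufficiently long words, and an element of the Cuntz algebra is
  determined by its products with the \<open>s\<^sub>w\<close> for \<open>w\<close> of a fixed length, which can be prescribed arbitrarily.
  Hence every isomorphism \<open>\<phi>\<close> between such ideals is implemented by a unique element \<open>x\<close> with
  \<open>x s\<^sub>u = s\<^bsub>\<phi> u\<^esub>\<close> on its domain; uniqueness makes \<open>\<phi> \<mapsto> x\<close> multiplicative and insensitive to maximum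
  extension. It is injective because \<open>w \<mapsto> s\<^sub>w\<close> is, as soon as \<open>1 \<noteq> 0\<close>. The latter follows from the universal
  property, applied to a Cuntz family of isometries on the Hilbert space of square-summable sequences.
  An operator is taken to be adjointable and bounded, so that no representation theorem is needed to
  obtain the adjoint.\<close>

section \<open>Square-summable sequences\<close>

text \<open>The relations in \<open>cuntz_family\<close> also hold in the zero algebra, where every
  product of generators is the same element and nothing could be embedded. What excludes that
  algebra is a unital homomorphism into one nonzero test algebra of the prescribed type, so a
  complete C*-algebra of operators and a Cuntz family in it have to be built explicitly.

  The embedding itself is ring theory. Iterating the last Cuntz relation shows that the elements s_w
  times adjoint of s_w, for w of length N, sum to 1. Hence the element implementing \<phi> is the
  sum over these w of s_v times adjoint of s_w, where v is the value of \<phi> at w; it is produced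
  below letter by letter rather than written down. Working with words of one large length also
  removes the need to choose generating sets or prefix codes for the ideals.

  The group laws are checked on the image, where associativity is that of the algebra.\<close>

definition l2 :: "(nat \<Rightarrow> complex) set" where
  "l2 = {x. summable (\<lambda>i. (cmod (x i))\<^sup>2)}"

definition l2norm :: "(nat \<Rightarrow> complex) \<Rightarrow> real" where
  "l2norm x = sqrt (\<Sum>i. (cmod (x i))\<^sup>2)"

definition l2inner :: "(nat \<Rightarrow> complex) \<Rightarrow> (nat \<Rightarrow> complex) \<Rightarrow> complex" where
  "l2inner x y = (\<Sum>i. cnj (x i) * y i)"

definition cscale :: "complex \<Rightarrow> (nat \<Rightarrow> complex) \<Rightarrow> nat \<Rightarrow> complex" where
  "cscale c x = (\<lambda>i. c * x i)"

lemma cscale_apply [simp]: "cscale c x i = c * x i"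
  by (simp add: cscale_def)

lemma l2norm_nonneg [simp]: "x \<in> l2 \<Longrightarrow> 0 \<le> l2norm x"
  by (simp add: l2_def l2norm_def suminf_nonneg)

lemma L2_set_le_l2norm:
  assumes "x \<in> l2"
  shows "L2_set (\<lambda>i. cmod (x i)) {..<m} \<le> l2norm x"
  using assms unfolding L2_set_def l2norm_def l2_def
  by (auto intro!: sum_le_suminf)

text \<open>Finite sections control both membership and norm, so inequalities for
  \<open>L2_set\<close> pass to sequences without handling infinite sums.\<close>

lemma l2_norm_leI:
  assumes "\<And>m. L2_set (\<lambda>i. cmod (x i)) {..<m} \<le> K"
  shows "x \<in> l2" "l2norm x \<le> K"
proof -
  have K: "0 \<le> K" using assms[of 0] by simp
  have b: "(\<Sum>i<m. (cmod (x i))\<^sup>2) \<le> K\<^sup>2" for m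
    using assms[of m] unfolding L2_set_def by (rule real_sqrt_le_iff[THEN iffD1, OF order_trans]) (use K in simp)
  have s: "summable (\<lambda>i. (cmod (x i))\<^sup>2)"
    by (rule bounded_imp_summable[of _ "K\<^sup>2"]) (use b[of "Suc _"] in \<open>auto simp: lessThan_Suc_atMost\<close>)
  then show "x \<in> l2" by (simp add: l2_def)
  have "(\<Sum>i. (cmod (x i))\<^sup>2) \<le> K\<^sup>2" using s b by (rule suminf_le_const)
  then show "l2norm x \<le> K" unfolding l2norm_def using K by (simp add: real_le_lsqrt)
qed

lemma
  assumes "x \<in> l2" "y \<in> l2"
  shows l2_add: "x + y \<in> l2" and l2norm_triangle: "l2norm (x + y) \<le> l2norm x + l2norm y"
proof -
  have "L2_set (\<lambda>i. cmod ((x + y) i)) {..<m} \<le> l2norm x + l2norm y" for m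
  proof -
    have "L2_set (\<lambda>i. cmod ((x + y) i)) {..<m} \<le> L2_set (\<lambda>i. cmod (x i) + cmod (y i)) {..<m}"
      by (rule L2_set_mono) (auto intro: norm_triangle_ineq)
    also have "\<dots> \<le> L2_set (\<lambda>i. cmod (x i)) {..<m} + L2_set (\<lambda>i. cmod (y i)) {..<m}"
      by (rule L2_set_triangle_ineq)
    finally show ?thesis using L2_set_le_l2norm[OF assms(1), of m] L2_set_le_l2norm[OF assms(2), of m] by linarith
  qed
  then show "x + y \<in> l2" "l2norm (x + y) \<le> l2norm x + l2norm y" by (rule l2_norm_leI)+
qed

lemma l2_cscale:
  assumes "x \<in> l2"
  shows "cscale c x \<in> l2"
  using assms by (simp add: l2_def norm_mult power_mult_distrib summable_mult)

lemma l2norm_cscale: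
  assumes "x \<in> l2"
  shows "l2norm (cscale c x) = cmod c * l2norm x"
  using assms by (simp add: l2_def l2norm_def norm_mult power_mult_distrib suminf_mult real_sqrt_mult)

lemma l2_zero [simp]: "0 \<in> l2" by (simp add: l2_def)

lemma cscale_zero [simp]: "cscale c 0 = 0" by (simp add: fun_eq_iff)

lemma l2norm_zero [simp]: "l2norm 0 = 0" by (simp add: l2norm_def)

lemma uminus_eq_cscale: "- x = cscale (- 1) x"
  by (auto simp: cscale_def)

lemma l2_diff:
  assumes "x \<in> l2" "y \<in> l2"
  shows "x - y \<in> l2"
  using l2_add[OF assms(1) l2_cscale[OF assms(2), of "-1"]] by (simp flip: uminus_eq_cscale)

lemma summable_l2inner:
  assumes "x \<in> l2" "y \<in> l2"
  shows "summable (\<lambda>i. cnj (x i) * y i)"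
proof (rule summable_norm_cancel, rule summable_comparison_test')
  show "summable (\<lambda>i. (cmod (x i))\<^sup>2 + (cmod (y i))\<^sup>2)"
    using assms by (auto simp: l2_def intro: summable_add)
  show "norm (norm (cnj (x i) * y i)) \<le> (cmod (x i))\<^sup>2 + (cmod (y i))\<^sup>2" for i
  proof -
    have "0 \<le> (cmod (x i) - cmod (y i))\<^sup>2" by simp
    then have "2 * (cmod (x i) * cmod (y i)) \<le> (cmod (x i))\<^sup>2 + (cmod (y i))\<^sup>2"
      by (simp add: power2_eq_square algebra_simps)
    moreover have "0 \<le> cmod (x i) * cmod (y i)" by simp
    ultimately have "cmod (x i) * cmod (y i) \<le> (cmod (x i))\<^sup>2 + (cmod (y i))\<^sup>2" by linarith
    then show ?thesis by (simp add: norm_mult)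
  qed
qed

lemma l2inner_Cauchy_Schwarz:
  assumes "x \<in> l2" "y \<in> l2"
  shows "cmod (l2inner x y) \<le> l2norm x * l2norm y"
proof (rule tendsto_upperbound)
  show "(\<lambda>m. norm (\<Sum>i<m. cnj (x i) * y i)) \<longlonglongrightarrow> cmod (l2inner x y)"
    unfolding l2inner_def by (intro tendsto_norm summable_LIMSEQ summable_l2inner assms)
  have "norm (\<Sum>i<m. cnj (x i) * y i) \<le> l2norm x * l2norm y" for m
  proof -
    have "norm (\<Sum>i<m. cnj (x i) * y i) \<le> (\<Sum>i<m. \<bar>cmod (x i)\<bar> * \<bar>cmod (y i)\<bar>)"
      by (rule order_trans[OF norm_sum]) (simp add: norm_mult)
    also have "\<dots> \<le> L2_set (\<lambda>i. cmod (x i)) {..<m} * L2_set (\<lambda>i. cmod (y i)) {..<m}"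
      by (rule L2_set_mult_ineq)
    also have "\<dots> \<le> l2norm x * l2norm y"
      by (intro mult_mono L2_set_le_l2norm assms) (use assms in auto)
    finally show ?thesis .
  qed
  then show "\<forall>\<^sub>F m in sequentially. norm (\<Sum>i<m. cnj (x i) * y i) \<le> l2norm x * l2norm y"
    by simp
qed simp

lemma l2inner_self:
  assumes "x \<in> l2"
  shows "l2inner x x = of_real ((l2norm x)\<^sup>2)"
proof -
  have s: "summable (\<lambda>i. (cmod (x i))\<^sup>2)" using assms by (simp add: l2_def)
  then have "l2inner x x = of_real (\<Sum>i. (cmod (x i))\<^sup>2)"
    unfolding l2inner_def suminf_of_real[OF s] by (metis complex_norm_square mult.commute)
  then show ?thesis using s by (simp add: l2norm_def suminf_nonneg)
qed

lemma l2norm_eq_0D: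
  assumes "x \<in> l2" "l2norm x = 0"
  shows "x = 0"
  using assms by (auto simp: l2_def l2norm_def suminf_eq_zero_iff)

lemma cnj_l2inner:
  assumes "x \<in> l2" "y \<in> l2"
  shows "cnj (l2inner x y) = l2inner y x"
  unfolding l2inner_def
  using sums_unique[OF summable_sums[OF summable_l2inner[OF assms], THEN sums_cnj[THEN iffD2]]]
  by (simp add: mult.commute)

lemma l2inner_add_right:
  assumes "x \<in> l2" "y \<in> l2" "z \<in> l2"
  shows "l2inner x (y + z) = l2inner x y + l2inner x z"
  unfolding l2inner_def using assms by (simp add: distrib_left suminf_add summable_l2inner)

lemma l2inner_add_left:
  assumes "x \<in> l2" "y \<in> l2" "z \<in> l2"
  shows "l2inner (x + y) z = l2inner x z + l2inner y z"
  unfolding l2inner_def using assms by (simp add: distrib_right suminf_add summable_l2inner)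

lemma l2inner_cscale_right:
  assumes "x \<in> l2" "y \<in> l2"
  shows "l2inner x (cscale c y) = c * l2inner x y"
  unfolding l2inner_def using suminf_mult[OF summable_l2inner[OF assms], of c]
  by (simp add: mult.left_commute)

lemma l2inner_cscale_left:
  assumes "x \<in> l2" "y \<in> l2"
  shows "l2inner (cscale c x) y = cnj c * l2inner x y"
  unfolding l2inner_def using suminf_mult[OF summable_l2inner[OF assms], of "cnj c"]
  by (simp add: mult.assoc)

lemma l2inner_diff_left:
  assumes "x \<in> l2" "y \<in> l2" "z \<in> l2"
  shows "l2inner (x - y) z = l2inner x z - l2inner y z"
  unfolding l2inner_def using assms by (simp add: left_diff_distrib suminf_diff summable_l2inner)

lemma l2inner_diff_right:
  assumes "x \<in> l2" "y \<in> l2" "z \<in> l2"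
  shows "l2inner x (y - z) = l2inner x y - l2inner x z"
  unfolding l2inner_def using assms by (simp add: right_diff_distrib suminf_diff summable_l2inner)

text \<open>The decisive test vector is \<open>x - y\<close>. Uniqueness of adjoints and linearity
  of operators rest on this separation property.\<close>

lemma l2_eqI:
  assumes "x \<in> l2" "y \<in> l2" "\<And>z. z \<in> l2 \<Longrightarrow> l2inner z x = l2inner z y"
  shows "x = y"
proof -
  have d: "x - y \<in> l2" using assms l2_diff by blast
  then have "l2inner (x - y) (x - y) = 0" using assms by (simp add: l2inner_diff_right)
  then have "l2norm (x - y) = 0" using l2inner_self[OF d] by simp
  then show ?thesis using l2norm_eq_0D[OF d] by simp
qed

text \<open>The limit inherits every bound \<open>e\<close> with the same threshold
  \<open>N\<close>. \<open>op_complete\<close> needs this rate to be uniform over all vectors, which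
  mere convergence would not give. The inequalities are weak because strict ones do not survive the
  limit.\<close>

lemma l2_complete:
  fixes f :: "nat \<Rightarrow> nat \<Rightarrow> complex"
  assumes f: "\<And>k. f k \<in> l2"
    and C: "\<And>e. e > 0 \<Longrightarrow> \<exists>N. \<forall>j\<ge>N. \<forall>k\<ge>N. l2norm (f j - f k) \<le> e"
  obtains x where "x \<in> l2"
    "\<And>N e. \<forall>j\<ge>N. \<forall>k\<ge>N. l2norm (f j - f k) \<le> e \<Longrightarrow> (\<forall>j\<ge>N. l2norm (f j - x) \<le> e)"
proof -
  have le: "cmod (z i) \<le> l2norm z" if "z \<in> l2" for z i
    using L2_set_le_l2norm[OF that, of "Suc i"] member_le_L2_set[of "{..<Suc i}" i "\<lambda>i. cmod (z i)"] by simp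
  have "Cauchy (\<lambda>k. f k i)" for i
  proof (rule CauchyI)
    fix e :: real assume "0 < e"
    then obtain N where N: "\<forall>j\<ge>N. \<forall>k\<ge>N. l2norm (f j - f k) \<le> e / 2" using C[of "e / 2"] by auto
    have "cmod (f j i - f k i) < e" if "j \<ge> N" "k \<ge> N" for j k
    proof -
      have "cmod ((f j - f k) i) \<le> e / 2" using N that le[OF l2_diff[OF f f], of j k i] by fastforce
      then show ?thesis using \<open>0 < e\<close> by simp
    qed
    then show "\<exists>M. \<forall>m\<ge>M. \<forall>n\<ge>M. norm (f m i - f n i) < e" by blast
  qed
  then have "\<exists>l. (\<lambda>k. f k i) \<longlonglongrightarrow> l" for i using Cauchy_convergent_iff convergentD by blast
  then obtain x where x: "\<And>i. (\<lambda>k. f k i) \<longlonglongrightarrow> x i" by metis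
  \<comment> \<open>Here \<open>x\<close> is the coordinatewise limit. For fixed \<open>j\<close>
    and a finite section, \<open>k\<close> tends to infinity. Membership of \<open>x\<close> itself
    follows later from that of \<open>f N\<close> and \<open>f N - x\<close>.\<close>
  have key: "f j - x \<in> l2 \<and> l2norm (f j - x) \<le> e"
    if "\<forall>j\<ge>N. \<forall>k\<ge>N. l2norm (f j - f k) \<le> e" "j \<ge> N" for N e j
  proof -
    have "L2_set (\<lambda>i. cmod ((f j - x) i)) {..<m} \<le> e" for m
    proof (rule tendsto_upperbound)
      show "(\<lambda>k. L2_set (\<lambda>i. cmod ((f j - f k) i)) {..<m}) \<longlonglongrightarrow> L2_set (\<lambda>i. cmod ((f j - x) i)) {..<m}"
        unfolding L2_set_def by (simp, intro tendsto_intros x)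
      have "L2_set (\<lambda>i. cmod ((f j - f k) i)) {..<m} \<le> e" if "k \<ge> N" for k
        using L2_set_le_l2norm[OF l2_diff[OF f f], of j k m] that \<open>j \<ge> N\<close>
          \<open>\<forall>j\<ge>N. \<forall>k\<ge>N. l2norm (f j - f k) \<le> e\<close> by fastforce
      then show "\<forall>\<^sub>F k in sequentially. L2_set (\<lambda>i. cmod ((f j - f k) i)) {..<m} \<le> e"
        using eventually_sequentially by blast
    qed simp
    then show ?thesis using l2_norm_leI[of "f j - x" e] by blast
  qed
  obtain N where "\<forall>j\<ge>N. \<forall>k\<ge>N. l2norm (f j - f k) \<le> 1" using C[of 1] by auto
  then have "f N - x \<in> l2" using key by blast
  then have "f N - (f N - x) \<in> l2" using f l2_diff by blast
  then have "x \<in> l2" by simp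
  then show ?thesis using that key by blast
qed

section \<open>Bounded operators\<close>

type_synonym seq_op = "(nat \<Rightarrow> complex) \<Rightarrow> nat \<Rightarrow> complex"

text \<open>Operators are total functions on all sequences. The value 0 outside \<open>l2\<close>
  makes agreement on \<open>l2\<close> the same as equality of HOL functions.\<close>

definition l2map :: "seq_op \<Rightarrow> bool" where
  "l2map T \<longleftrightarrow> (\<forall>x\<in>l2. T x \<in> l2) \<and> (\<forall>x. x \<notin> l2 \<longrightarrow> T x = 0)"

definition adjoint_pair :: "seq_op \<Rightarrow> seq_op \<Rightarrow> bool" where
  "adjoint_pair T T' \<longleftrightarrow> l2map T \<and> l2map T' \<and>
     (\<forall>x\<in>l2. \<forall>y\<in>l2. l2inner (T x) y = l2inner x (T' y))"

text \<open>Linearity comes from the adjoint: see \<open>op_add_arg\<close> and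
  \<open>op_cscale_arg\<close>.\<close>

definition l2ops :: "seq_op set" where
  "l2ops = {T. (\<exists>T'. adjoint_pair T T') \<and> (\<exists>C\<ge>0. \<forall>x\<in>l2. l2norm (T x) \<le> C * l2norm x)}"

definition op_adj :: "seq_op \<Rightarrow> seq_op" where
  "op_adj T = (THE T'. adjoint_pair T T')"

definition op_norm :: "seq_op \<Rightarrow> real" where
  "op_norm T = Inf {C. 0 \<le> C \<and> (\<forall>x\<in>l2. l2norm (T x) \<le> C * l2norm x)}"

definition op_scale :: "complex \<Rightarrow> seq_op \<Rightarrow> seq_op" where
  "op_scale c T = (\<lambda>x. cscale c (T x))"

definition op_id :: seq_op where
  "op_id x = (if x \<in> l2 then x else 0)"

lemma op_scale_apply [simp]: "op_scale c T x = cscale c (T x)"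
  by (simp add: op_scale_def)

lemma adjoint_pair_unique:
  assumes "adjoint_pair T T1" "adjoint_pair T T2"
  shows "T1 = T2"
proof
  fix x show "T1 x = T2 x"
    by (cases "x \<in> l2") (use assms in \<open>auto simp: adjoint_pair_def l2map_def intro!: l2_eqI\<close>)
qed

lemma adjoint_pair_sym:
  assumes "adjoint_pair T T'"
  shows "adjoint_pair T' T"
  using assms unfolding adjoint_pair_def l2map_def by (metis cnj_l2inner)

lemma op_adj_eqI:
  assumes "adjoint_pair T T'"
  shows "op_adj T = T'"
  unfolding op_adj_def using assms adjoint_pair_unique by blast

lemma adjoint_pair_op_adj: "T \<in> l2ops \<Longrightarrow> adjoint_pair T (op_adj T)"
  unfolding l2ops_def using op_adj_eqI by auto

lemma l2ops_map [simp]: "T \<in> l2ops \<Longrightarrow> x \<in> l2 \<Longrightarrow> T x \<in> l2"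
  and l2ops_outside: "T \<in> l2ops \<Longrightarrow> x \<notin> l2 \<Longrightarrow> T x = 0"
  by (auto simp: l2ops_def adjoint_pair_def l2map_def)

lemma op_norm_le:
  assumes "0 \<le> C" "\<And>x. x \<in> l2 \<Longrightarrow> l2norm (T x) \<le> C * l2norm x"
  shows "op_norm T \<le> C"
  unfolding op_norm_def using assms by (intro cInf_lower) (auto intro!: bdd_belowI)

text \<open>The infimum in \<open>op_norm\<close> is attained: for a vector of nonzero norm, every
  admissible constant bounds the same quotient of norms, hence so does their infimum.\<close>

lemma
  assumes "T \<in> l2ops"
  shows op_norm_nonneg: "0 \<le> op_norm T"
    and l2norm_op_le: "x \<in> l2 \<Longrightarrow> l2norm (T x) \<le> op_norm T * l2norm x"
proof -
  let ?S = "{C. 0 \<le> C \<and> (\<forall>x\<in>l2. l2norm (T x) \<le> C * l2norm x)}"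
  have ne: "?S \<noteq> {}" using assms by (auto simp: l2ops_def)
  show "0 \<le> op_norm T" unfolding op_norm_def using ne by (intro cInf_greatest) auto
  show "l2norm (T x) \<le> op_norm T * l2norm x" if x: "x \<in> l2"
  proof (cases "l2norm x = 0")
    case True
    then show ?thesis using ne x by auto
  next
    case False
    then have p: "0 < l2norm x" using l2norm_nonneg[OF x] by linarith
    have "l2norm (T x) / l2norm x \<le> op_norm T"
      unfolding op_norm_def by (rule cInf_greatest[OF ne]) (use p x in \<open>auto simp: divide_le_eq\<close>)
    then show ?thesis using p by (simp add: divide_le_eq)
  qed
qed

lemma l2opsI:
  assumes "adjoint_pair T T'" "0 \<le> C" "\<And>x. x \<in> l2 \<Longrightarrow> l2norm (T x) \<le> C * l2norm x"
  shows "T \<in> l2ops"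
  using assms by (auto simp: l2ops_def)

lemma op_eqI:
  assumes "T \<in> l2ops" "S \<in> l2ops" "\<And>x. x \<in> l2 \<Longrightarrow> T x = S x"
  shows "T = S"
proof
  fix x show "T x = S x" by (cases "x \<in> l2") (simp_all add: assms l2ops_outside)
qed

lemma l2inner_op_adj:
  assumes "T \<in> l2ops" "x \<in> l2" "y \<in> l2"
  shows "l2inner (T x) y = l2inner x (op_adj T y)"
  using adjoint_pair_op_adj[OF assms(1)] assms by (auto simp: adjoint_pair_def)

text \<open>Moving \<open>T\<close> to the other side of the inner product leaves its argument bare,
  and there \<open>l2inner\<close> is additive.\<close>

lemma op_add_arg:
  assumes "T \<in> l2ops" "x \<in> l2" "y \<in> l2"
  shows "T (x + y) = T x + T y"
proof -
  note p = adjoint_pair_sym[OF adjoint_pair_op_adj[OF assms(1)], unfolded adjoint_pair_def l2map_def]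
  have "l2inner z (T (x + y)) = l2inner z (T x + T y)" if z: "z \<in> l2" for z
  proof -
    have "l2inner z (T (x + y)) = l2inner (op_adj T z) (x + y)" using p z assms l2_add by metis
    also have "\<dots> = l2inner (op_adj T z) x + l2inner (op_adj T z) y"
      using p z assms l2inner_add_right by blast
    also have "\<dots> = l2inner z (T x) + l2inner z (T y)" using p z assms by simp
    finally show ?thesis using p z assms by (simp add: l2inner_add_right)
  qed
  then show ?thesis using assms by (intro l2_eqI) (auto simp: l2_add)
qed

lemma op_cscale_arg:
  assumes "T \<in> l2ops" "x \<in> l2"
  shows "T (cscale c x) = cscale c (T x)"
proof -
  note p = adjoint_pair_sym[OF adjoint_pair_op_adj[OF assms(1)], unfolded adjoint_pair_def l2map_def]
  have "l2inner z (T (cscale c x)) = l2inner z (cscale c (T x))" if z: "z \<in> l2" for z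
  proof -
    have "l2inner z (T (cscale c x)) = l2inner (op_adj T z) (cscale c x)" using p z assms l2_cscale by metis
    also have "\<dots> = c * l2inner (op_adj T z) x"
      using p z assms l2inner_cscale_right by blast
    also have "\<dots> = c * l2inner z (T x)" using p z assms by simp
    finally show ?thesis using p z assms by (simp add: l2inner_cscale_right)
  qed
  then show ?thesis using assms by (intro l2_eqI) (auto simp: l2_cscale)
qed

lemma adjoint_pair_add:
  assumes "adjoint_pair T T'" "adjoint_pair S S'"
  shows "adjoint_pair (T + S) (T' + S')"
  using assms unfolding adjoint_pair_def l2map_def
  by (auto simp: l2_add l2inner_add_left l2inner_add_right)

lemma adjoint_pair_scale:
  assumes "adjoint_pair T T'"
  shows "adjoint_pair (op_scale c T) (op_scale (cnj c) T')"
  using assms unfolding adjoint_pair_def l2map_def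
  by (auto simp: l2_cscale l2inner_cscale_left l2inner_cscale_right)

lemma adjoint_pair_comp:
  assumes "adjoint_pair T T'" "adjoint_pair S S'" "T \<in> l2ops" "S' \<in> l2ops"
  shows "adjoint_pair (T \<circ> S) (S' \<circ> T')"
proof -
  \<comment> \<open>Outside \<open>l2\<close> the inner factor returns 0, so the composite vanishes
    there only if the outer factor fixes 0. This is additivity at \<open>0 + 0\<close>.\<close>
  have "T 0 = 0" "S' 0 = 0"
    using op_add_arg[OF assms(3), of 0 0] op_add_arg[OF assms(4), of 0 0] by auto
  then show ?thesis using assms(1,2) unfolding adjoint_pair_def l2map_def by auto
qed

text \<open>With \<open>op_adj T y\<close> itself as test vector, Cauchy-Schwarz bounds the square
  of its norm by its norm times \<open>op_norm T * l2norm y\<close>; a nonzero factor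
  cancels.\<close>

lemma
  assumes T: "T \<in> l2ops"
  shows op_adj_closed: "op_adj T \<in> l2ops" and op_norm_adj_le: "op_norm (op_adj T) \<le> op_norm T"
proof -
  note p = adjoint_pair_op_adj[OF T]
  have b: "l2norm (op_adj T y) \<le> op_norm T * l2norm y" if y: "y \<in> l2" for y
  proof (cases "l2norm (op_adj T y) = 0")
    case True
    then show ?thesis using op_norm_nonneg[OF T] y by simp
  next
    case False
    let ?z = "op_adj T y"
    have z: "?z \<in> l2" using p y by (auto simp: adjoint_pair_def l2map_def)
    then have pos: "0 < l2norm ?z" using False l2norm_nonneg[OF z] by linarith
    have "of_real ((l2norm ?z)\<^sup>2) = l2inner (T ?z) y"
      using l2inner_self[OF z] l2inner_op_adj[OF T z y] by simp
    then have "(l2norm ?z)\<^sup>2 = cmod (l2inner (T ?z) y)"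
      by (metis norm_of_real abs_power2)
    also have "\<dots> \<le> l2norm (T ?z) * l2norm y" by (rule l2inner_Cauchy_Schwarz) (use T z y in auto)
    also have "\<dots> \<le> (op_norm T * l2norm ?z) * l2norm y"
      using l2norm_op_le[OF T z] y by (intro mult_right_mono) auto
    finally have "l2norm ?z * l2norm ?z \<le> l2norm ?z * (op_norm T * l2norm y)"
      by (simp add: power2_eq_square algebra_simps)
    then show ?thesis using pos by simp
  qed
  show "op_adj T \<in> l2ops" using adjoint_pair_sym[OF p] op_norm_nonneg[OF T] b by (rule l2opsI)
  show "op_norm (op_adj T) \<le> op_norm T" using op_norm_nonneg[OF T] b by (rule op_norm_le)
qed

lemma op_adj_adj: "T \<in> l2ops \<Longrightarrow> op_adj (op_adj T) = T"
  using adjoint_pair_op_adj adjoint_pair_sym op_adj_eqI by blast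

lemma op_norm_adj: "T \<in> l2ops \<Longrightarrow> op_norm (op_adj T) = op_norm T"
  using op_norm_adj_le op_norm_adj_le[OF op_adj_closed] op_adj_adj by fastforce

lemma
  assumes T: "T \<in> l2ops" and S: "S \<in> l2ops"
  shows op_add_closed: "T + S \<in> l2ops"
    and op_adj_add: "op_adj (T + S) = op_adj T + op_adj S"
    and op_norm_triangle: "op_norm (T + S) \<le> op_norm T + op_norm S"
proof -
  note p = adjoint_pair_add[OF adjoint_pair_op_adj[OF T] adjoint_pair_op_adj[OF S]]
  have n: "0 \<le> op_norm T + op_norm S" using op_norm_nonneg T S by simp
  have b: "l2norm ((T + S) x) \<le> (op_norm T + op_norm S) * l2norm x" if x: "x \<in> l2" for x
  proof -
    have "l2norm ((T + S) x) \<le> l2norm (T x) + l2norm (S x)"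
      using l2norm_triangle[of "T x" "S x"] T S x by simp
    then show ?thesis using l2norm_op_le[OF T x] l2norm_op_le[OF S x] by (simp add: distrib_right)
  qed
  show "T + S \<in> l2ops" using p n b by (rule l2opsI)
  show "op_norm (T + S) \<le> op_norm T + op_norm S" using n b by (rule op_norm_le)
  show "op_adj (T + S) = op_adj T + op_adj S" using p by (rule op_adj_eqI)
qed

lemma
  assumes T: "T \<in> l2ops"
  shows op_scale_closed: "op_scale c T \<in> l2ops"
    and op_adj_scale: "op_adj (op_scale c T) = op_scale (cnj c) (op_adj T)"
    and op_norm_scale_le: "op_norm (op_scale c T) \<le> cmod c * op_norm T"
proof -
  note p = adjoint_pair_scale[OF adjoint_pair_op_adj[OF T], of c]
  have n: "0 \<le> cmod c * op_norm T" using op_norm_nonneg T by simp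
  have b: "l2norm (op_scale c T x) \<le> (cmod c * op_norm T) * l2norm x" if x: "x \<in> l2" for x
    using l2norm_op_le[OF T x] T x by (simp add: l2norm_cscale mult.assoc mult_left_mono)
  show "op_scale c T \<in> l2ops" using p n b by (rule l2opsI)
  show "op_norm (op_scale c T) \<le> cmod c * op_norm T" using n b by (rule op_norm_le)
  show "op_adj (op_scale c T) = op_scale (cnj c) (op_adj T)" using p by (rule op_adj_eqI)
qed

text \<open>The missing inequality is \<open>op_norm_scale_le\<close> for the inverse scalar
  \<open>1 / c\<close>.\<close>

lemma op_norm_scale:
  assumes T: "T \<in> l2ops"
  shows "op_norm (op_scale c T) = cmod c * op_norm T"
proof (cases "c = 0")
  case True
  then show ?thesis using op_norm_scale_le[OF T, of c] op_norm_nonneg[OF op_scale_closed[OF T], of c] by simp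
next
  case False
  then have "op_scale (1 / c) (op_scale c T) = T" by (auto simp: op_scale_def cscale_def)
  then have "op_norm T \<le> cmod (1 / c) * op_norm (op_scale c T)"
    using op_norm_scale_le[OF op_scale_closed[OF T], of "1 / c" c] by simp
  then have "cmod c * op_norm T \<le> op_norm (op_scale c T)"
    using False by (simp add: norm_divide field_simps)
  then show ?thesis using op_norm_scale_le[OF T, of c] by simp
qed

lemma
  assumes T: "T \<in> l2ops" and S: "S \<in> l2ops"
  shows op_comp_closed: "T \<circ> S \<in> l2ops"
    and op_adj_comp: "op_adj (T \<circ> S) = op_adj S \<circ> op_adj T"
    and op_norm_comp: "op_norm (T \<circ> S) \<le> op_norm T * op_norm S"
proof -
  note p = adjoint_pair_comp[OF adjoint_pair_op_adj[OF T] adjoint_pair_op_adj[OF S] T op_adj_closed[OF S]]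
  have n: "0 \<le> op_norm T * op_norm S" using op_norm_nonneg T S by simp
  have b: "l2norm ((T \<circ> S) x) \<le> (op_norm T * op_norm S) * l2norm x" if x: "x \<in> l2" for x
  proof -
    have "l2norm (T (S x)) \<le> op_norm T * l2norm (S x)" using l2norm_op_le[OF T] S x by simp
    also have "\<dots> \<le> op_norm T * (op_norm S * l2norm x)"
      using l2norm_op_le[OF S x] op_norm_nonneg[OF T] by (rule mult_left_mono)
    finally show ?thesis by (simp add: mult.assoc)
  qed
  show "T \<circ> S \<in> l2ops" using p n b by (rule l2opsI)
  show "op_norm (T \<circ> S) \<le> op_norm T * op_norm S" using n b by (rule op_norm_le)
  show "op_adj (T \<circ> S) = op_adj S \<circ> op_adj T" using p by (rule op_adj_eqI)
qed

lemma op_id_closed: "op_id \<in> l2ops"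
  by (rule l2opsI[of op_id op_id 1]) (auto simp: adjoint_pair_def l2map_def op_id_def)

lemma op_zero_closed: "0 \<in> l2ops"
  by (rule l2opsI[of 0 0 0]) (auto simp: adjoint_pair_def l2map_def l2inner_def)

lemma op_uminus: "- T = op_scale (- 1) T"
  by (auto simp: op_scale_def cscale_def fun_eq_iff)

lemma op_uminus_closed: "T \<in> l2ops \<Longrightarrow> - T \<in> l2ops"
  unfolding op_uminus by (rule op_scale_closed)

lemma op_diff_closed: "T \<in> l2ops \<Longrightarrow> S \<in> l2ops \<Longrightarrow> T - S \<in> l2ops"
  using op_add_closed[OF _ op_uminus_closed, of T S] by simp

lemma op_adj_diff:
  assumes "T \<in> l2ops" "S \<in> l2ops"
  shows "op_adj (T - S) = op_adj T - op_adj S"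
proof -
  have "op_adj (T + op_scale (- 1) S) = op_adj T + op_scale (- 1) (op_adj S)"
    using assms by (simp add: op_adj_add op_adj_scale op_scale_closed)
  then show ?thesis by (simp flip: op_uminus)
qed

lemma op_norm_eq_0_iff:
  assumes "T \<in> l2ops"
  shows "op_norm T = 0 \<longleftrightarrow> T = 0"
proof
  assume 0: "op_norm T = 0"
  show "T = 0"
  proof (rule op_eqI[OF assms op_zero_closed])
    fix x :: "nat \<Rightarrow> complex" assume x: "x \<in> l2"
    have "l2norm (T x) = 0" using l2norm_op_le[OF assms x] l2norm_nonneg[OF l2ops_map[OF assms x]] 0 by simp
    then show "T x = 0 x" using l2norm_eq_0D assms x by simp
  qed
next
  assume "T = 0"
  then have "op_norm T \<le> 0" by (auto intro!: op_norm_le)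
  then show "op_norm T = 0" using op_norm_nonneg[OF assms] by simp
qed

text \<open>For the nontrivial direction, the square of \<open>l2norm (T x)\<close> is the inner
  product of \<open>x\<close> with \<open>op_adj T (T x)\<close>, and Cauchy-Schwarz makes the
  square root of the left-hand norm a bound for \<open>T\<close>.\<close>

lemma op_cstar_identity:
  assumes T: "T \<in> l2ops"
  shows "op_norm (op_adj T \<circ> T) = (op_norm T)\<^sup>2"
proof (rule antisym)
  show "op_norm (op_adj T \<circ> T) \<le> (op_norm T)\<^sup>2"
    using op_norm_comp[OF op_adj_closed[OF T] T] by (simp add: op_norm_adj T power2_eq_square)
  let ?K = "op_norm (op_adj T \<circ> T)"
  have c: "op_adj T \<circ> T \<in> l2ops" using T by (simp add: op_comp_closed op_adj_closed)
  have "op_norm T \<le> sqrt ?K"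
  proof (rule op_norm_le)
    show "0 \<le> sqrt ?K" using op_norm_nonneg[OF c] by simp
    fix x assume x: "x \<in> l2"
    then have Tx: "T x \<in> l2" using T by simp
    have "of_real ((l2norm (T x))\<^sup>2) = l2inner x ((op_adj T \<circ> T) x)"
      using l2inner_self[OF Tx] l2inner_op_adj[OF T x Tx] by simp
    then have "(l2norm (T x))\<^sup>2 = cmod (l2inner x ((op_adj T \<circ> T) x))"
      by (metis norm_of_real abs_power2)
    also have "\<dots> \<le> l2norm x * l2norm ((op_adj T \<circ> T) x)"
      by (rule l2inner_Cauchy_Schwarz[OF x l2ops_map[OF c x]])
    also have "\<dots> \<le> l2norm x * (?K * l2norm x)"
      by (rule mult_left_mono[OF l2norm_op_le[OF c x] l2norm_nonneg[OF x]])
    finally have "(l2norm (T x))\<^sup>2 \<le> (sqrt ?K * l2norm x)\<^sup>2"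
      using op_norm_nonneg[OF c] by (simp add: power_mult_distrib power2_eq_square mult_ac)
    then show "l2norm (T x) \<le> sqrt ?K * l2norm x"
      by (rule power2_le_imp_le) (use op_norm_nonneg[OF c] x in simp)
  qed
  then show "(op_norm T)\<^sup>2 \<le> ?K"
    using op_norm_nonneg[OF T] op_norm_nonneg[OF c] by (metis power_mono real_sqrt_pow2)
qed

lemma op_complete:
  fixes f :: "nat \<Rightarrow> seq_op"
  assumes f: "\<And>k. f k \<in> l2ops"
    and C: "\<And>e. e > 0 \<Longrightarrow> \<exists>N. \<forall>j\<ge>N. \<forall>k\<ge>N. op_norm (f j - f k) < e"
  shows "\<exists>T\<in>l2ops. (\<lambda>k. op_norm (f k - T)) \<longlonglongrightarrow> 0"
proof -
  \<comment> \<open>Strong limits exist both for the sequence and for its adjoints, and they are adjoint to each other.\<close>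
  have lim: "\<exists>T. l2map T \<and> (\<forall>N e. 0 \<le> e \<longrightarrow> (\<forall>j\<ge>N. \<forall>k\<ge>N. op_norm (g j - g k) \<le> e) \<longrightarrow>
               (\<forall>x\<in>l2. \<forall>j\<ge>N. l2norm (g j x - T x) \<le> e * l2norm x))"
    if g: "\<And>k. g k \<in> l2ops"
      and gC: "\<And>e. e > 0 \<Longrightarrow> \<exists>N. \<forall>j\<ge>N. \<forall>k\<ge>N. op_norm (g j - g k) < e" for g :: "nat \<Rightarrow> seq_op"
  proof -
    have b: "l2norm (g j x - g k x) \<le> e * l2norm x" if "op_norm (g j - g k) \<le> e" "x \<in> l2" for j k e x
      using l2norm_op_le[OF op_diff_closed[OF g g] that(2), of j k] that
        mult_right_mono[OF that(1) l2norm_nonneg[OF that(2)]] by simp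
    have "\<exists>y. y \<in> l2 \<and> (\<forall>N e. (\<forall>j\<ge>N. \<forall>k\<ge>N. l2norm (g j x - g k x) \<le> e) \<longrightarrow> (\<forall>j\<ge>N. l2norm (g j x - y) \<le> e))"
      if x: "x \<in> l2" for x
    proof (rule l2_complete[of "\<lambda>k. g k x"])
      show "g k x \<in> l2" for k using g x by simp
      fix e :: real assume e: "0 < e"
      \<comment> \<open>The summand 1 avoids division by zero when \<open>x\<close> has norm
        0.\<close>
      define d where "d = e / (l2norm x + 1)"
      have p: "0 < l2norm x + 1" using l2norm_nonneg[OF x] by linarith
      have d: "0 < d" "d * l2norm x \<le> e" using e p by (auto simp: d_def field_simps)
      then obtain N where "\<forall>j\<ge>N. \<forall>k\<ge>N. op_norm (g j - g k) < d" using gC by blast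
      then have "\<forall>j\<ge>N. \<forall>k\<ge>N. l2norm (g j x - g k x) \<le> e" using b[OF _ x] d(2) by (meson less_imp_le order_trans)
      then show "\<exists>N. \<forall>j\<ge>N. \<forall>k\<ge>N. l2norm (g j x - g k x) \<le> e" by blast
    qed blast
    then obtain T where T: "\<And>x. x \<in> l2 \<Longrightarrow> T x \<in> l2 \<and>
        (\<forall>N e. (\<forall>j\<ge>N. \<forall>k\<ge>N. l2norm (g j x - g k x) \<le> e) \<longrightarrow> (\<forall>j\<ge>N. l2norm (g j x - T x) \<le> e))"
      by metis
    have "\<forall>j\<ge>N. l2norm (g j x - T x) \<le> e * l2norm x"
      if "\<forall>j\<ge>N. \<forall>k\<ge>N. op_norm (g j - g k) \<le> e" "x \<in> l2" for N e x
      using T[OF that(2)] b[OF _ that(2)] that(1) by blast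
    then show ?thesis
      by (intro exI[of _ "\<lambda>x. if x \<in> l2 then T x else 0"]) (use T in \<open>simp add: l2map_def\<close>)
  qed
  obtain T where T: "l2map T" "\<And>N e x j. 0 \<le> e \<Longrightarrow> \<forall>j\<ge>N. \<forall>k\<ge>N. op_norm (f j - f k) \<le> e \<Longrightarrow>
      x \<in> l2 \<Longrightarrow> j \<ge> N \<Longrightarrow> l2norm (f j x - T x) \<le> e * l2norm x"
    using lim[OF f C] by blast
  define g where "g k = op_adj (f k)" for k
  have g: "g k \<in> l2ops" for k by (simp add: g_def f op_adj_closed)
  \<comment> \<open>Taking adjoints is isometric, so the adjoint sequence is Cauchy with the same
    thresholds and \<open>lim\<close> applies to it as well.\<close>
  have gf: "op_norm (g j - g k) = op_norm (f j - f k)" for j k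
    by (simp add: g_def f op_norm_adj op_diff_closed flip: op_adj_diff)
  obtain S where S: "l2map S" "\<And>N e x j. 0 \<le> e \<Longrightarrow> \<forall>j\<ge>N. \<forall>k\<ge>N. op_norm (f j - f k) \<le> e \<Longrightarrow>
      x \<in> l2 \<Longrightarrow> j \<ge> N \<Longrightarrow> l2norm (g j x - S x) \<le> e * l2norm x"
    using lim[OF g, unfolded gf, OF C] by blast
  have "l2inner (T x) y = l2inner x (S y)" if x: "x \<in> l2" and y: "y \<in> l2" for x y
  proof -
    have l: "T x \<in> l2" "S y \<in> l2" using T(1) S(1) x y by (auto simp: l2map_def)
    have "cmod (l2inner (T x) y - l2inner x (S y)) \<le> 0"
    proof (rule field_le_epsilon)
      fix e :: real assume e: "0 < e"
      define K where "K = 2 * l2norm x * l2norm y"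
      have K: "0 \<le> K" using x y by (simp add: K_def)
      define d where "d = e / (K + 1)"
      have d: "0 < d" "d * K \<le> e" using e K by (auto simp: d_def field_simps)
      obtain N where "\<forall>j\<ge>N. \<forall>k\<ge>N. op_norm (f j - f k) < d" using C d by blast
      then have N: "\<forall>j\<ge>N. \<forall>k\<ge>N. op_norm (f j - f k) \<le> d" by (meson less_imp_le)
      have m: "f N x \<in> l2" "g N y \<in> l2" using f g x y by auto
      \<comment> \<open>The terms with \<open>f N\<close> and \<open>g N\<close> cancel because
        these two are adjoint; only the two approximation errors remain.\<close>
      have eq: "l2inner (T x) y - l2inner x (S y) = l2inner x (g N y - S y) - l2inner (f N x - T x) y"
        using l m x y l2inner_op_adj[OF f x y, of N]
        by (simp add: l2inner_diff_left l2inner_diff_right g_def)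
      have "cmod (l2inner (T x) y - l2inner x (S y)) \<le> cmod (l2inner x (g N y - S y)) + cmod (l2inner (f N x - T x) y)"
        unfolding eq by (rule norm_triangle_ineq4)
      also have "\<dots> \<le> l2norm x * l2norm (g N y - S y) + l2norm (f N x - T x) * l2norm y"
        by (rule add_mono[OF l2inner_Cauchy_Schwarz l2inner_Cauchy_Schwarz]) (use l m x y in \<open>auto simp: l2_diff\<close>)
      also have "\<dots> \<le> l2norm x * (d * l2norm y) + (d * l2norm x) * l2norm y"
        using T(2)[OF _ N x, of N] S(2)[OF _ N y, of N] d(1) x y
        by (intro add_mono[OF mult_left_mono mult_right_mono]) simp_all
      also have "\<dots> = d * K" by (simp add: K_def)
      finally show "cmod (l2inner (T x) y - l2inner x (S y)) \<le> 0 + e" using d by simp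
    qed
    then show ?thesis by simp
  qed
  then have p: "adjoint_pair T S" using T(1) S(1) by (simp add: adjoint_pair_def)
  \<comment> \<open>From \<open>N0\<close> on the sequence stays within 1 of \<open>f N0\<close>.
    The same then holds for the limit, which gives the bound \<open>op_norm (f N0) + 1\<close> for
    \<open>T\<close>.\<close>
  obtain N0 where "\<forall>j\<ge>N0. \<forall>k\<ge>N0. op_norm (f j - f k) < 1" using C[of 1] by auto
  then have N0: "\<forall>j\<ge>N0. \<forall>k\<ge>N0. op_norm (f j - f k) \<le> 1" by (meson less_imp_le)
  have Tops: "T \<in> l2ops"
  proof (rule l2opsI[OF p])
    show "0 \<le> op_norm (f N0) + 1" using op_norm_nonneg[OF f, of N0] by simp
    fix x :: "nat \<Rightarrow> complex" assume x: "x \<in> l2"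
    then have l: "T x \<in> l2" "f N0 x \<in> l2" using T(1) f by (auto simp: l2map_def)
    have "T x = f N0 x + cscale (- 1) (f N0 x - T x)" by (simp flip: uminus_eq_cscale)
    then have "l2norm (T x) \<le> l2norm (f N0 x) + l2norm (cscale (- 1) (f N0 x - T x))"
      using l2norm_triangle[OF l(2) l2_cscale[OF l2_diff[OF l(2,1)], of "- 1"]] by simp
    also have "\<dots> = l2norm (f N0 x) + l2norm (f N0 x - T x)"
      using l by (simp add: l2norm_cscale l2_diff)
    also have "\<dots> \<le> op_norm (f N0) * l2norm x + 1 * l2norm x"
      by (intro add_mono l2norm_op_le f x T(2)[OF _ N0]) auto
    finally show "l2norm (T x) \<le> (op_norm (f N0) + 1) * l2norm x" by (simp add: distrib_right)
  qed
  have "(\<lambda>k. op_norm (f k - T)) \<longlonglongrightarrow> 0"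
  proof (rule LIMSEQ_I)
    fix e :: real assume e: "0 < e"
    then obtain N where "\<forall>j\<ge>N. \<forall>k\<ge>N. op_norm (f j - f k) < e / 2" using C[of "e / 2"] by auto
    then have N: "\<forall>j\<ge>N. \<forall>k\<ge>N. op_norm (f j - f k) \<le> e / 2" by (meson less_imp_le)
    have "op_norm (f k - T) \<le> e / 2" if "k \<ge> N" for k
      by (rule op_norm_le) (use e T(2)[OF _ N _ that] in auto)
    then show "\<exists>no. \<forall>n\<ge>no. norm (op_norm (f n - T) - 0) < e"
      using e op_norm_nonneg[OF op_diff_closed[OF f Tops]] by (intro exI[of _ N]) fastforce
  qed
  then show ?thesis using Tops by blast
qed

section \<open>The operators as a unital C*-algebra\<close>

definition l2_algebra :: "seq_op cstar" where
  "l2_algebra = \<lparr>carrier = l2ops, mult = (\<circ>), one = op_id, zero = 0, add = (+),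
     smult = op_scale, star = op_adj, cnorm = op_norm\<rparr>"

lemma l2_algebra_simps [simp]:
  "carrier l2_algebra = l2ops" "mult l2_algebra = (\<circ>)" "one l2_algebra = op_id"
  "zero l2_algebra = 0" "add l2_algebra = (+)" "smult l2_algebra = op_scale"
  "star l2_algebra = op_adj" "cnorm l2_algebra = op_norm"
  by (simp_all add: l2_algebra_def)

lemma cring_complex_ring: "cring complex_ring"
  unfolding complex_ring_def
  by (rule cringI)
     (auto intro!: abelian_groupI comm_monoidI simp: algebra_simps add_eq_0_iff)

lemma abelian_group_l2_algebra: "abelian_group l2_algebra"
  by (rule abelian_groupI)
     (auto simp: op_add_closed op_zero_closed add_ac intro!: bexI[of _ "- _"] op_uminus_closed)

lemma ring_l2_algebra: "ring l2_algebra"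
proof (rule ringI[OF abelian_group_l2_algebra])
  show "monoid l2_algebra"
    by (rule monoidI)
       (auto simp: op_comp_closed op_id_closed comp_assoc op_id_def intro!: op_eqI)
  show "(x \<oplus>\<^bsub>l2_algebra\<^esub> y) \<otimes>\<^bsub>l2_algebra\<^esub> z = x \<otimes>\<^bsub>l2_algebra\<^esub> z \<oplus>\<^bsub>l2_algebra\<^esub> y \<otimes>\<^bsub>l2_algebra\<^esub> z" for x y z
    by (simp add: fun_eq_iff)
  show "z \<otimes>\<^bsub>l2_algebra\<^esub> (x \<oplus>\<^bsub>l2_algebra\<^esub> y) = z \<otimes>\<^bsub>l2_algebra\<^esub> x \<oplus>\<^bsub>l2_algebra\<^esub> z \<otimes>\<^bsub>l2_algebra\<^esub> y"
    if "x \<in> carrier l2_algebra" "y \<in> carrier l2_algebra" "z \<in> carrier l2_algebra" for x y z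
    using that by (intro op_eqI) (simp_all add: op_comp_closed op_add_closed op_add_arg fun_eq_iff[where 'b = complex])
qed

lemma l2_algebra_minus:
  assumes "T \<in> l2ops" "S \<in> l2ops"
  shows "T \<ominus>\<^bsub>l2_algebra\<^esub> S = T - S"
proof -
  interpret ring l2_algebra by (rule ring_l2_algebra)
  have "\<ominus>\<^bsub>l2_algebra\<^esub> S = - S"
    using assms by (intro minus_equality) (auto simp: op_uminus_closed)
  then show ?thesis by (simp add: a_minus_def)
qed

lemma unital_cstar_algebra_l2_algebra: "unital_cstar_algebra l2_algebra"
proof (intro unital_cstar_algebra.intro unital_cstar_algebra_axioms.intro ring_l2_algebra)
  show "Module.module complex_ring l2_algebra"
    by (rule moduleI[OF cring_complex_ring abelian_group_l2_algebra])
       (auto simp: complex_ring_def op_scale_closed, auto simp: op_scale_def cscale_def fun_eq_iff algebra_simps)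
next
  fix f :: "nat \<Rightarrow> seq_op"
  assume f: "\<And>k. f k \<in> carrier l2_algebra"
    and C: "\<And>e. e > 0 \<Longrightarrow> \<exists>N. \<forall>j\<ge>N. \<forall>k\<ge>N. \<parallel>f j \<ominus>\<^bsub>l2_algebra\<^esub> f k\<parallel>\<^bsub>l2_algebra\<^esub> < e"
  then show "\<exists>x\<in>carrier l2_algebra. (\<lambda>k. \<parallel>f k \<ominus>\<^bsub>l2_algebra\<^esub> x\<parallel>\<^bsub>l2_algebra\<^esub>) \<longlonglongrightarrow> 0"
    using op_complete[of f] by (auto simp: l2_algebra_minus)
next
  fix x y :: seq_op and c
  assume "x \<in> carrier l2_algebra" "y \<in> carrier l2_algebra"
  then show "x \<otimes>\<^bsub>l2_algebra\<^esub> (c \<odot>\<^bsub>l2_algebra\<^esub> y) = c \<odot>\<^bsub>l2_algebra\<^esub> (x \<otimes>\<^bsub>l2_algebra\<^esub> y)"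
    by (intro op_eqI) (simp_all add: op_comp_closed op_scale_closed op_cscale_arg fun_eq_iff[where 'b = complex])
qed (auto simp: op_scale_def fun_eq_iff op_adj_closed op_adj_adj op_adj_add op_adj_scale[unfolded op_scale_def]
  op_adj_comp op_norm_nonneg op_norm_eq_0_iff op_norm_scale[unfolded op_scale_def] op_norm_triangle
  op_norm_comp op_cstar_identity)

section \<open>A Cuntz family of isometries\<close>

text \<open>For \<open>r < n\<close>, the isometry taking basis vector number \<open>k\<close> to
  number \<open>n * k + r\<close>. The residue classes modulo \<open>n\<close> cut the index set
  into \<open>n\<close> infinite copies of itself, which is why such isometries form a Cuntz family.
  Its adjoint is \<open>compress\<close>.\<close>

definition spread :: "nat \<Rightarrow> nat \<Rightarrow> seq_op" where
  "spread n r x = (\<lambda>m. if x \<in> l2 \<and> m mod n = r then x (m div n) else 0)"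

definition compress :: "nat \<Rightarrow> nat \<Rightarrow> seq_op" where
  "compress n r y = (\<lambda>k. if y \<in> l2 then y (n * k + r) else 0)"

lemma spread_outside: "m \<notin> range (\<lambda>k. n * k + r) \<Longrightarrow> spread n r x m = 0"
  by (auto simp: spread_def image_iff) (metis mult_div_mod_eq)

lemma spread_apply: "x \<in> l2 \<Longrightarrow> r < n \<Longrightarrow> q < n \<Longrightarrow> spread n r x (n * k + q) = (if q = r then x k else 0)"
  by (simp add: spread_def)

lemma compress_apply: "y \<in> l2 \<Longrightarrow> compress n r y k = y (n * k + r)"
  by (simp add: compress_def)

lemma compress_outside: "y \<notin> l2 \<Longrightarrow> compress n r y = (\<lambda>_. 0)"
  by (simp add: compress_def)

text \<open>The map \<open>n * k + r\<close> is strictly increasing in \<open>k\<close> and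
  \<open>spread n r x\<close> vanishes off its range, so each series over all indices is a reindexed
  series over \<open>k\<close>.\<close>

lemma
  assumes "r < n"
  shows spread_in_l2: "x \<in> l2 \<Longrightarrow> spread n r x \<in> l2"
    and l2norm_spread: "x \<in> l2 \<Longrightarrow> l2norm (spread n r x) = l2norm x"
    and compress_in_l2: "x \<in> l2 \<Longrightarrow> compress n r x \<in> l2"
    and l2inner_spread: "x \<in> l2 \<Longrightarrow> y \<in> l2 \<Longrightarrow> l2inner (spread n r x) y = l2inner x (compress n r y)"
proof -
  let ?g = "\<lambda>k. n * k + r"
  have g: "strict_mono ?g" using assms by (intro strict_monoI) simp
  have z: "(cmod (spread n r x m))\<^sup>2 = 0" if "m \<notin> range ?g" for m and x :: "nat \<Rightarrow> complex"
    using spread_outside[OF that] by simp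
  show "spread n r x \<in> l2" if "x \<in> l2"
    using summable_mono_reindex[where f = "\<lambda>m. (cmod (spread n r x m))\<^sup>2", OF g z] that assms by (simp add: l2_def[unfolded set_eq_iff] spread_apply)
  show "l2norm (spread n r x) = l2norm x" if "x \<in> l2"
    using suminf_mono_reindex[where f = "\<lambda>m. (cmod (spread n r x m))\<^sup>2", OF g z] that assms by (simp add: l2norm_def spread_apply)
  show "compress n r x \<in> l2" if "x \<in> l2"
    using summable_reindex[of "\<lambda>i. (cmod (x i))\<^sup>2" ?g] that strict_mono_imp_inj_on[OF g]
    by (simp add: l2_def compress_def comp_def)
  show "l2inner (spread n r x) y = l2inner x (compress n r y)" if "x \<in> l2" "y \<in> l2"
  proof -
    have "\<And>m. m \<notin> range ?g \<Longrightarrow> cnj (spread n r x m) * y m = 0" using spread_outside by simp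
    from suminf_mono_reindex[where f = "\<lambda>m. cnj (spread n r x m) * y m", OF g this] show ?thesis
      using that assms by (simp add: l2inner_def spread_apply compress_def)
  qed
qed

lemma adjoint_pair_spread: "r < n \<Longrightarrow> adjoint_pair (spread n r) (compress n r)"
  by (auto simp: adjoint_pair_def l2map_def spread_in_l2 compress_in_l2 l2inner_spread)
     (auto simp: spread_def compress_def)

lemma spread_closed: "r < n \<Longrightarrow> spread n r \<in> l2ops"
  by (rule l2opsI[OF adjoint_pair_spread, of _ _ 1]) (auto simp: l2norm_spread)

lemma compress_spread:
  assumes "q < n" "r < n"
  shows "compress n q \<circ> spread n r = (if q = r then op_id else 0)"
proof (intro ext)
  fix x k show "(compress n q \<circ> spread n r) x k = (if q = r then op_id else 0) x k"
  proof (cases "x \<in> l2")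
    case True
    then show ?thesis using assms by (simp add: compress_def spread_in_l2 spread_apply op_id_def)
  next
    case False
    then have "spread n r x = 0" by (auto simp: spread_def)
    then show ?thesis using False by (simp add: compress_def op_id_def)
  qed
qed

lemma finsum_l2_algebra:
  assumes "finite I" "\<And>i. i \<in> I \<Longrightarrow> T i \<in> l2ops"
  shows "(\<Oplus>\<^bsub>l2_algebra\<^esub>i\<in>I. T i) x m = (\<Sum>i\<in>I. T i x m)"
proof -
  interpret ring l2_algebra by (rule ring_l2_algebra)
  show ?thesis using assms by (induction I rule: finite_induct) (simp_all add: finsum_insert Pi_def)
qed

text \<open>Generators are numbered from 1 and residues from 0, hence the shift
  \<open>i - 1\<close>.\<close>

lemma cuntz_family_l2_algebra:
  assumes "0 < n"
  shows "cuntz_family n l2_algebra (\<lambda>i. spread n (i - 1))"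
proof -
  note adj = op_adj_eqI[OF adjoint_pair_spread]
  have less: "i - 1 < n" if "i \<in> {1..n}" for i :: nat using that by auto
  have closed: "spread n (i - 1) \<in> l2ops" "compress n (i - 1) \<in> l2ops" if "i \<in> {1..n}" for i
    using spread_closed[OF less[OF that]] op_adj_closed adj[OF less[OF that]] by fastforce+
  have rel: "compress n (i - 1) \<circ> spread n (j - 1) = (if i = j then op_id else 0)"
    if "i \<in> {1..n}" "j \<in> {1..n}" for i j
  proof -
    have "i - 1 = j - 1 \<longleftrightarrow> i = j" using that by auto
    then show ?thesis using compress_spread[OF less less] that by simp
  qed
  have "(\<Oplus>\<^bsub>l2_algebra\<^esub>i\<in>{1..n}. spread n (i - 1) \<circ> op_adj (spread n (i - 1))) = op_id"
  proof (intro ext)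
    fix x m
    have "(\<Oplus>\<^bsub>l2_algebra\<^esub>i\<in>{1..n}. spread n (i - 1) \<circ> op_adj (spread n (i - 1))) x m
        = (\<Sum>i\<in>{1..n}. spread n (i - 1) (op_adj (spread n (i - 1)) x) m)"
      by (subst finsum_l2_algebra)
         (simp_all add: op_comp_closed op_adj_closed closed del: One_nat_def)
    \<comment> \<open>Each summand projects onto the coordinates in one residue class, and
      coordinate \<open>m\<close> lies in exactly one class.\<close>
    also have "\<dots> = (\<Sum>i\<in>{1..n}. if i = Suc (m mod n) then op_id x m else 0)"
    proof (rule sum.cong[OF refl])
      fix i assume i: "i \<in> {1..n}"
      then have "i = Suc (m mod n) \<longleftrightarrow> m mod n = i - 1" by auto
      then show "spread n (i - 1) (op_adj (spread n (i - 1)) x) m = (if i = Suc (m mod n) then op_id x m else 0)"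
        using i mult_div_mod_eq[of n m] compress_in_l2[OF less[OF i], of x]
        by (auto simp: adj less spread_def op_id_def compress_apply compress_outside)
    qed
    also have "\<dots> = op_id x m" using assms by (simp add: Suc_leI)
    finally show "(\<Oplus>\<^bsub>l2_algebra\<^esub>i\<in>{1..n}. spread n (i - 1) \<circ> op_adj (spread n (i - 1))) x m = op_id x m" .
  qed
  then show ?thesis unfolding cuntz_family_def using rel
    by (auto simp: closed adj[OF less] simp del: One_nat_def)
qed

lemma op_id_neq_0: "op_id \<noteq> 0"
proof
  assume "op_id = 0"
  define e :: "nat \<Rightarrow> complex" where "e = (\<lambda>i. if i = 0 then 1 else 0)"
  have "e \<in> l2" unfolding l2_def by (auto simp: e_def intro!: summable_finite[of "{0}"] split: if_splits)
  then have "op_id e 0 = 1" by (simp add: op_id_def e_def)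
  then show False by (simp add: \<open>op_id = 0\<close>)
qed

lemma cuntz_algebra_nontrivial:
  assumes "cuntz_algebra n M s" "0 < n"
  shows "\<one>\<^bsub>M\<^esub> \<noteq> \<zero>\<^bsub>M\<^esub>"
proof
  assume e: "\<one>\<^bsub>M\<^esub> = \<zero>\<^bsub>M\<^esub>"
  obtain h where h: "h \<in> unital_star_hom M l2_algebra"
    using assms unital_cstar_algebra_l2_algebra cuntz_family_l2_algebra
    unfolding cuntz_algebra_def by blast
  have "ring M" using assms by (simp add: cuntz_algebra_def unital_cstar_algebra_def)
  then have "h \<zero>\<^bsub>M\<^esub> = \<zero>\<^bsub>l2_algebra\<^esub>"
    using h ring_l2_algebra ring_hom_zero unfolding unital_star_hom_def by blast
  moreover have "h \<one>\<^bsub>M\<^esub> = \<one>\<^bsub>l2_algebra\<^esub>" using h ring_hom_one unfolding unital_star_hom_def by blast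
  ultimately show False using e op_id_neq_0 by simp
qed

section \<open>Right-ideal isomorphisms\<close>

text \<open>For finite \<open>A\<close> this says that only finitely many words over
  \<open>A\<close> are missing from \<open>R\<close>. In this form the condition passes easily to
  larger sets, intersections and composites.\<close>

definition contains_long :: "'a set \<Rightarrow> 'a list set \<Rightarrow> bool" where
  "contains_long A R \<longleftrightarrow> (\<exists>N. \<forall>w\<in>lists A. N \<le> length w \<longrightarrow> w \<in> R)"

lemma contains_longI: "(\<And>w. w \<in> lists A \<Longrightarrow> N \<le> length w \<Longrightarrow> w \<in> R) \<Longrightarrow> contains_long A R"
  by (auto simp: contains_long_def)

lemma contains_long_mono: "contains_long A R \<Longrightarrow> R \<subseteq> S \<Longrightarrow> contains_long A S"
  by (auto simp: contains_long_def)

lemma contains_long_Int: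
  assumes "contains_long A R" "contains_long A S"
  shows "contains_long A (R \<inter> S)"
proof -
  obtain M N where "\<forall>w\<in>lists A. M \<le> length w \<longrightarrow> w \<in> R" "\<forall>w\<in>lists A. N \<le> length w \<longrightarrow> w \<in> S"
    using assms by (auto simp: contains_long_def)
  then show ?thesis by (intro contains_longI[of _ "max M N"]) auto
qed

lemma ex_long_word:
  assumes "A \<noteq> {}"
  shows "\<exists>z\<in>lists A. length z = N"
proof -
  obtain a where "a \<in> A" using assms by auto
  then have "replicate N a \<in> lists A" by (auto simp: in_lists_conv_set)
  then show ?thesis by (metis length_replicate)
qed

lemma split_long_word:
  assumes "w \<in> lists A" "N \<le> length w"
  obtains u z where "w = u @ z" "u \<in> lists A" "z \<in> lists A" "length u = N"
  by (rule that[of "take N w" "drop N w"]) (use assms in \<open>auto dest: in_set_takeD in_set_dropD\<close>)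

text \<open>If \<open>w\<close> is at least as long as every generator, the right ideal generated by
  \<open>w\<close> meets \<open>R\<close>, so some generator is a prefix of an extension of
  \<open>w\<close>, and by its length a prefix of \<open>w\<close>. Conversely, every word has an
  extension long enough to lie in \<open>R\<close>, and the words of \<open>R\<close> up to length
  \<open>N\<close> generate \<open>R\<close>; there are finitely many as \<open>A\<close> is
  finite.\<close>

lemma essential_finitely_generated_iff:
  assumes "finite A" "A \<noteq> {}" "right_ideal A R"
  shows "essential A R \<and> finitely_generated A R \<longleftrightarrow> contains_long A R"
proof
  assume *: "essential A R \<and> finitely_generated A R"
  then obtain P where P: "finite P" "P \<subseteq> lists A" "R = {p @ x |p x. p \<in> P \<and> x \<in> lists A}"
    unfolding finitely_generated_def by blast
  obtain N where N: "\<forall>p\<in>P. length p \<le> N"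
    using P(1) finite_nat_set_iff_bounded_le[of "length ` P"] by auto
  show "contains_long A R"
  proof (rule contains_longI)
    fix w assume w: "w \<in> lists A" "N \<le> length w"
    let ?S = "{w @ z |z. z \<in> lists A}"
    have "right_ideal A ?S" using w(1) unfolding right_ideal_def by auto
    moreover have "w \<in> ?S" by (intro CollectI exI[of _ "[]"]) simp
    ultimately have "R \<inter> ?S \<noteq> {}" using * unfolding essential_def by blast
    then obtain p x z where px: "p \<in> P" "x \<in> lists A" "z \<in> lists A" "p @ x = w @ z"
      unfolding P(3) by blast
    have "p = take (length p) (w @ z)" by (simp flip: px(4))
    then have "p = take (length p) w" using bspec[OF N px(1)] w(2) by simp
    then obtain y where y: "w = p @ y" by (metis append_take_drop_id)
    then have "y \<in> lists A" using w(1) by simp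
    then show "w \<in> R" unfolding P(3) y using px(1) by blast
  qed
next
  assume "contains_long A R"
  then obtain N where "\<forall>w\<in>lists A. N \<le> length w \<longrightarrow> w \<in> R" unfolding contains_long_def by blast
  then have N: "\<And>w. w \<in> lists A \<Longrightarrow> N \<le> length w \<Longrightarrow> w \<in> R" by blast
  have "R \<inter> S \<noteq> {}" if S: "right_ideal A S" "S \<noteq> {}" for S
  proof -
    obtain u where u: "u \<in> S" using S by auto
    obtain z where z: "z \<in> lists A" "length z = N" using ex_long_word[OF assms(2)] by blast
    have "u \<in> lists A" using S u by (auto simp: right_ideal_def)
    then have "u @ z \<in> R" using z by (intro N) auto
    moreover have "u @ z \<in> S" using S u z by (auto simp: right_ideal_def)
    ultimately show ?thesis by blast
  qed
  then have "essential A R" using assms(3) by (simp add: essential_def)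
  moreover have "finitely_generated A R"
    unfolding finitely_generated_def
  proof (intro exI conjI)
    let ?P = "{w \<in> R. length w \<le> N}"
    have R: "R \<subseteq> lists A" using assms(3) by (simp add: right_ideal_def)
    then have "?P \<subseteq> {xs. set xs \<subseteq> A \<and> length xs \<le> N}" by auto
    then show "finite ?P" using finite_lists_length_le[OF assms(1)] finite_subset by blast
    show "?P \<subseteq> lists A" using R by auto
    show "R = {p @ x |p x. p \<in> ?P \<and> x \<in> lists A}"
    proof (intro equalityI subsetI)
      fix w assume w: "w \<in> R"
      show "w \<in> {p @ x |p x. p \<in> ?P \<and> x \<in> lists A}"
      proof (cases "length w \<le> N")
        case True
        then show ?thesis using w by (intro CollectI exI[of _ w] exI[of _ "[]"]) auto
      next
        case False
        then have "N \<le> length w" by simp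
        with subsetD[OF R w] obtain u z where u: "w = u @ z" "u \<in> lists A" "z \<in> lists A" "length u = N"
          by (rule split_long_word)
        then have "u \<in> R" by (intro N) auto
        then show ?thesis using u by (intro CollectI exI[of _ u] exI[of _ z]) simp
      qed
    qed (use assms(3) in \<open>auto simp: right_ideal_def\<close>)
  qed
  ultimately show "essential A R \<and> finitely_generated A R" ..
qed

text \<open>In this form the notion is visibly symmetric under exchanging arguments and values.\<close>

lemma right_ideal_iso_iff:
  "right_ideal_iso A \<phi> \<longleftrightarrow>
     (\<forall>u v. \<phi> u = Some v \<longrightarrow> u \<in> lists A \<and> v \<in> lists A \<and> (\<forall>x\<in>lists A. \<phi> (u @ x) = Some (v @ x))) \<and>
     (\<forall>u u' v. \<phi> u = Some v \<longrightarrow> \<phi> u' = Some v \<longrightarrow> u = u')"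
  (is "?L \<longleftrightarrow> ?R")
proof
  assume ?L
  then show ?R unfolding right_ideal_iso_def right_ideal_def
    by (auto simp: inj_on_def dom_def ran_def subset_iff)
next
  assume ?R
  then show ?L unfolding right_ideal_iso_def right_ideal_def
    by (auto simp: inj_on_def dom_def ran_def subset_iff simp del: in_lists_conv_set) blast+
qed

lemma right_ideal_isoI:
  assumes "\<And>u v. \<phi> u = Some v \<Longrightarrow> u \<in> lists A" "\<And>u v. \<phi> u = Some v \<Longrightarrow> v \<in> lists A"
    and "\<And>u v x. \<phi> u = Some v \<Longrightarrow> x \<in> lists A \<Longrightarrow> \<phi> (u @ x) = Some (v @ x)"
    and "\<And>u u' v. \<phi> u = Some v \<Longrightarrow> \<phi> u' = Some v \<Longrightarrow> u = u'"
  shows "right_ideal_iso A \<phi>"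
  unfolding right_ideal_iso_iff by (intro conjI allI impI ballI) (rule assms; assumption)+

lemma
  assumes "right_ideal_iso A \<phi>" "\<phi> u = Some v"
  shows right_ideal_iso_arg: "u \<in> lists A" and right_ideal_iso_val: "v \<in> lists A"
    and right_ideal_iso_append: "x \<in> lists A \<Longrightarrow> \<phi> (u @ x) = Some (v @ x)"
    and right_ideal_iso_inj: "\<phi> u' = Some v \<Longrightarrow> u' = u"
proof -
  note * = assms(1)[unfolded right_ideal_iso_iff]
  show "u \<in> lists A" "v \<in> lists A" using conjunct1[OF *] assms(2) by metis+
  show "\<phi> (u @ x) = Some (v @ x)" if "x \<in> lists A" using conjunct1[OF *] assms(2) that by metis
  show "u' = u" if "\<phi> u' = Some v" using conjunct2[OF *] assms(2) that by metis
qed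

definition inverse_map :: "('a \<rightharpoonup> 'b) \<Rightarrow> ('b \<rightharpoonup> 'a)" where
  "inverse_map \<phi> v = (if v \<in> ran \<phi> then Some (SOME u. \<phi> u = Some v) else None)"

lemma inverse_map_eq_Some_iff:
  assumes "right_ideal_iso A \<phi>"
  shows "inverse_map \<phi> v = Some u \<longleftrightarrow> \<phi> u = Some v"
  unfolding inverse_map_def using right_ideal_iso_inj[OF assms]
  by (auto simp: ran_def intro: someI)

lemma
  assumes "right_ideal_iso A \<phi>"
  shows right_ideal_iso_inverse_map: "right_ideal_iso A (inverse_map \<phi>)"
    and dom_inverse_map: "dom (inverse_map \<phi>) = ran \<phi>"
    and ran_inverse_map: "ran (inverse_map \<phi>) = dom \<phi>"
proof -
  note i = inverse_map_eq_Some_iff[OF assms]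
  show "right_ideal_iso A (inverse_map \<phi>)"
    by (rule right_ideal_isoI) (use right_ideal_iso_arg[OF assms] right_ideal_iso_val[OF assms]
        right_ideal_iso_append[OF assms] in \<open>auto simp: i\<close>)
  show "dom (inverse_map \<phi>) = ran \<phi>" "ran (inverse_map \<phi>) = dom \<phi>" by (auto simp: i dom_def ran_def)
qed

lemma inverse_map_inverse_map:
  assumes "right_ideal_iso A \<phi>"
  shows "inverse_map (inverse_map \<phi>) = \<phi>"
proof
  fix u
  have "inverse_map (inverse_map \<phi>) u = Some v \<longleftrightarrow> \<phi> u = Some v" for v
    by (simp add: inverse_map_eq_Some_iff[OF right_ideal_iso_inverse_map[OF assms]] inverse_map_eq_Some_iff[OF assms])
  then show "inverse_map (inverse_map \<phi>) u = \<phi> u" by (metis option.exhaust)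
qed

lemma inverse_map_le:
  assumes "right_ideal_iso A \<phi>" "right_ideal_iso A \<psi>" "\<phi> \<subseteq>\<^sub>m \<psi>"
  shows "inverse_map \<phi> \<subseteq>\<^sub>m inverse_map \<psi>"
proof (unfold map_le_def, intro ballI)
  fix v assume "v \<in> dom (inverse_map \<phi>)"
  then obtain u where u: "inverse_map \<phi> v = Some u" by auto
  then have "\<phi> u = Some v" using assms inverse_map_eq_Some_iff by metis
  then have "\<psi> u = Some v" using assms(3) by (metis domI map_le_def)
  then show "inverse_map \<phi> v = inverse_map \<psi> v" using u inverse_map_eq_Some_iff[OF assms(2)] by metis
qed

lemma right_ideal_iso_comp:
  assumes "right_ideal_iso A \<phi>" "right_ideal_iso A \<psi>"
  shows "right_ideal_iso A (\<phi> \<circ>\<^sub>m \<psi>)"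
proof (rule right_ideal_isoI)
  fix u v assume "(\<phi> \<circ>\<^sub>m \<psi>) u = Some v"
  then obtain w where w: "\<psi> u = Some w" "\<phi> w = Some v" by (auto simp: map_comp_Some_iff)
  show "u \<in> lists A" "v \<in> lists A"
    using right_ideal_iso_arg[OF assms(2) w(1)] right_ideal_iso_val[OF assms(1) w(2)] by auto
  show "(\<phi> \<circ>\<^sub>m \<psi>) (u @ x) = Some (v @ x)" if "x \<in> lists A" for x
    using right_ideal_iso_append[OF assms(2) w(1) that] right_ideal_iso_append[OF assms(1) w(2) that]
    by (simp add: map_comp_def)
next
  fix u u' v assume "(\<phi> \<circ>\<^sub>m \<psi>) u = Some v" "(\<phi> \<circ>\<^sub>m \<psi>) u' = Some v"
  then show "u = u'"
    using right_ideal_iso_inj[OF assms(1)] right_ideal_iso_inj[OF assms(2)] by (auto simp: map_comp_Some_iff)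
qed

text \<open>A prefix of length \<open>N\<close> already lies in the domain of \<open>\<psi>\<close>.
  The remaining letters, at least \<open>M\<close> of them, are carried along unchanged, so the
  value is long enough for \<open>\<phi>\<close>.\<close>

lemma contains_long_dom_comp:
  assumes "right_ideal_iso A \<phi>" "right_ideal_iso A \<psi>"
    and "contains_long A (dom \<phi>)" "contains_long A (dom \<psi>)"
  shows "contains_long A (dom (\<phi> \<circ>\<^sub>m \<psi>))"
proof -
  obtain M where "\<forall>w\<in>lists A. M \<le> length w \<longrightarrow> w \<in> dom \<phi>"
    using assms(3) unfolding contains_long_def by blast
  then have M: "\<And>w. w \<in> lists A \<Longrightarrow> M \<le> length w \<Longrightarrow> w \<in> dom \<phi>" by blast
  obtain N where "\<forall>w\<in>lists A. N \<le> length w \<longrightarrow> w \<in> dom \<psi>"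
    using assms(4) unfolding contains_long_def by blast
  then have N: "\<And>w. w \<in> lists A \<Longrightarrow> N \<le> length w \<Longrightarrow> w \<in> dom \<psi>" by blast
  show ?thesis
  proof (rule contains_longI[of _ "N + M"])
    fix w assume w: "w \<in> lists A" "N + M \<le> length w"
    then obtain u z where u: "w = u @ z" "u \<in> lists A" "z \<in> lists A" "length u = N"
      using split_long_word[of w A N] by auto
    then obtain v where v: "\<psi> u = Some v" using N[of u] by auto
    have "v @ z \<in> dom \<phi>" using right_ideal_iso_val[OF assms(2) v] u w by (intro M) auto
    then show "w \<in> dom (\<phi> \<circ>\<^sub>m \<psi>)"
      using right_ideal_iso_append[OF assms(2) v u(3)] u(1) by (auto simp: map_comp_Some_iff)
  qed
qed

lemma inverse_map_comp:
  assumes "right_ideal_iso A \<phi>" "right_ideal_iso A \<psi>"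
  shows "inverse_map (\<phi> \<circ>\<^sub>m \<psi>) = inverse_map \<psi> \<circ>\<^sub>m inverse_map \<phi>"
proof
  fix w
  have "inverse_map (\<phi> \<circ>\<^sub>m \<psi>) w = Some u \<longleftrightarrow> (inverse_map \<psi> \<circ>\<^sub>m inverse_map \<phi>) w = Some u" for u
    by (auto simp: inverse_map_eq_Some_iff[OF assms(1)] inverse_map_eq_Some_iff[OF assms(2)]
        inverse_map_eq_Some_iff[OF right_ideal_iso_comp[OF assms]] map_comp_Some_iff)
  then show "inverse_map (\<phi> \<circ>\<^sub>m \<psi>) w = (inverse_map \<psi> \<circ>\<^sub>m inverse_map \<phi>) w" by (metis option.exhaust)
qed

text \<open>This is the statement about domains, applied to the inverses in reverse order.\<close>

lemma contains_long_ran_comp: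
  assumes "right_ideal_iso A \<phi>" "right_ideal_iso A \<psi>"
    and "contains_long A (ran \<phi>)" "contains_long A (ran \<psi>)"
  shows "contains_long A (ran (\<phi> \<circ>\<^sub>m \<psi>))"
  using contains_long_dom_comp[OF right_ideal_iso_inverse_map right_ideal_iso_inverse_map, OF assms(2,1)] assms
  by (simp add: dom_inverse_map[OF assms(1)] dom_inverse_map[OF assms(2)]
      dom_inverse_map[OF right_ideal_iso_comp[OF assms(1,2)]] flip: inverse_map_comp[OF assms(1,2)])

section \<open>Maximum extensions\<close>

text \<open>The maximum extension is written down at once: it sends \<open>u\<close> to
  \<open>v\<close> whenever \<open>\<theta>\<close> sends \<open>u @ z\<close> to
  \<open>v @ z\<close> for all sufficiently long \<open>z\<close>.\<close>

lemma ex_max_ext: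
  assumes "A \<noteq> {}" "right_ideal_iso A \<theta>" "contains_long A (dom \<theta>)"
  shows "\<exists>\<psi>. right_ideal_iso A \<psi> \<and> \<theta> \<subseteq>\<^sub>m \<psi> \<and> (\<forall>\<chi>. right_ideal_iso A \<chi> \<and> \<theta> \<subseteq>\<^sub>m \<chi> \<longrightarrow> \<chi> \<subseteq>\<^sub>m \<psi>)"
proof -
  define E where "E u v \<longleftrightarrow> u \<in> lists A \<and> v \<in> lists A \<and>
    (\<exists>N. \<forall>z\<in>lists A. N \<le> length z \<longrightarrow> \<theta> (u @ z) = Some (v @ z))" for u v
  \<comment> \<open>Two pairs can be tested with one common suffix. This reduces single-valuedness
    and injectivity of the new map to those of \<open>\<theta>\<close>.\<close>
  have E2: "\<exists>z. \<theta> (u @ z) = Some (v @ z) \<and> \<theta> (u' @ z) = Some (v' @ z)" if E: "E u v" "E u' v'" for u v u' v'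
  proof -
    obtain N N' where N: "\<forall>z\<in>lists A. N \<le> length z \<longrightarrow> \<theta> (u @ z) = Some (v @ z)"
      "\<forall>z\<in>lists A. N' \<le> length z \<longrightarrow> \<theta> (u' @ z) = Some (v' @ z)" using E unfolding E_def by blast
    obtain z where "z \<in> lists A" "length z = max N N'" using ex_long_word[OF assms(1)] by blast
    then show ?thesis using N by (intro exI[of _ z]) auto
  qed
  have Ev: "v = v'" if "E u v" "E u v'" for u v v' using E2[OF that] by auto
  have Eu: "u = u'" if "E u v" "E u' v" for u u' v
    using E2[OF that] right_ideal_iso_inj[OF assms(2)] by (metis append_same_eq)
  define \<psi> where "\<psi> u = (if \<exists>v. E u v then Some (SOME v. E u v) else None)" for u
  have \<psi>: "\<psi> u = Some v \<longleftrightarrow> E u v" for u v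
    unfolding \<psi>_def using Ev by (auto intro: someI)
  have El: "u \<in> lists A" "v \<in> lists A" if "E u v" for u v using that unfolding E_def by blast+
  have Ex: "E (u @ x) (v @ x)" if E: "E u v" and x: "x \<in> lists A" for u v x
  proof -
    obtain N where N: "\<forall>z\<in>lists A. N \<le> length z \<longrightarrow> \<theta> (u @ z) = Some (v @ z)"
      using E unfolding E_def by blast
    then have "\<forall>z\<in>lists A. N \<le> length z \<longrightarrow> \<theta> ((u @ x) @ z) = Some ((v @ x) @ z)" using x by auto
    moreover have "u @ x \<in> lists A" "v @ x \<in> lists A" using El[OF E] x by simp_all
    ultimately show ?thesis unfolding E_def by blast
  qed
  have iso: "right_ideal_iso A \<psi>"
    by (rule right_ideal_isoI; unfold \<psi>; rule El Ex Eu; assumption)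
  obtain N where "\<forall>w\<in>lists A. N \<le> length w \<longrightarrow> w \<in> dom \<theta>"
    using assms(3) unfolding contains_long_def by blast
  then have N: "\<And>w. w \<in> lists A \<Longrightarrow> N \<le> length w \<Longrightarrow> w \<in> dom \<theta>" by blast
  \<comment> \<open>Where \<open>\<chi>\<close> is defined, appending a long \<open>z\<close> leads
    into the domain of \<open>\<theta>\<close>, so the values of \<open>\<chi>\<close> satisfy the
    condition defining \<open>E\<close>.\<close>
  have max: "\<chi> \<subseteq>\<^sub>m \<psi>" if \<chi>: "right_ideal_iso A \<chi>" "\<theta> \<subseteq>\<^sub>m \<chi>" for \<chi>
  proof (unfold map_le_def, intro ballI)
    fix u assume "u \<in> dom \<chi>"
    then obtain v where v: "\<chi> u = Some v" by auto
    have "\<theta> (u @ z) = Some (v @ z)" if z: "z \<in> lists A" "N \<le> length z" for z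
    proof -
      have "u @ z \<in> dom \<theta>" using right_ideal_iso_arg[OF \<chi>(1) v] z by (intro N) auto
      then show ?thesis using right_ideal_iso_append[OF \<chi>(1) v z(1)] \<chi>(2) by (simp add: map_le_def)
    qed
    then have "E u v" unfolding E_def using right_ideal_iso_arg[OF \<chi>(1) v] right_ideal_iso_val[OF \<chi>(1) v] by blast
    then show "\<chi> u = \<psi> u" using v \<psi> by metis
  qed
  \<comment> \<open>The instance of \<open>max\<close> at \<open>\<theta>\<close> itself shows that
    \<open>\<psi>\<close> extends \<open>\<theta>\<close>.\<close>
  show ?thesis using iso max max[OF assms(2)] by auto
qed

lemma
  assumes "A \<noteq> {}" "right_ideal_iso A \<theta>" "contains_long A (dom \<theta>)"
  shows right_ideal_iso_max_ext: "right_ideal_iso A (max_ext A \<theta>)"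
    and le_max_ext: "\<theta> \<subseteq>\<^sub>m max_ext A \<theta>"
    and max_ext_greatest: "right_ideal_iso A \<chi> \<Longrightarrow> \<theta> \<subseteq>\<^sub>m \<chi> \<Longrightarrow> \<chi> \<subseteq>\<^sub>m max_ext A \<theta>"
proof -
  obtain \<psi> where \<psi>: "right_ideal_iso A \<psi> \<and> \<theta> \<subseteq>\<^sub>m \<psi> \<and> (\<forall>\<chi>. right_ideal_iso A \<chi> \<and> \<theta> \<subseteq>\<^sub>m \<chi> \<longrightarrow> \<chi> \<subseteq>\<^sub>m \<psi>)"
    using ex_max_ext[OF assms] by blast
  then have "max_ext A \<theta> = \<psi>"
    unfolding max_ext_def by (intro the_equality) (auto intro: map_le_antisym)
  with \<psi> show "right_ideal_iso A (max_ext A \<theta>)" "\<theta> \<subseteq>\<^sub>m max_ext A \<theta>"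
    "right_ideal_iso A \<chi> \<Longrightarrow> \<theta> \<subseteq>\<^sub>m \<chi> \<Longrightarrow> \<chi> \<subseteq>\<^sub>m max_ext A \<theta>" by auto
qed

lemma ran_mono: "\<phi> \<subseteq>\<^sub>m \<psi> \<Longrightarrow> ran \<phi> \<subseteq> ran \<psi>"
  by (force simp: map_le_def ran_def dom_def)

section \<open>The Thompson--Higman group\<close>

lemma carrier_thompson_higman:
  assumes "finite A" "A \<noteq> {}"
  shows "\<phi> \<in> carrier (thompson_higman A) \<longleftrightarrow>
    right_ideal_iso A \<phi> \<and> contains_long A (dom \<phi>) \<and> contains_long A (ran \<phi>) \<and>
    (\<forall>\<psi>. right_ideal_iso A \<psi> \<and> \<phi> \<subseteq>\<^sub>m \<psi> \<longrightarrow> \<psi> = \<phi>)"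
proof -
  have "right_ideal_iso A \<phi> \<Longrightarrow> right_ideal A (dom \<phi>) \<and> right_ideal A (ran \<phi>)"
    by (simp add: right_ideal_iso_def)
  then show ?thesis
    using essential_finitely_generated_iff[OF assms] by (auto simp: thompson_higman_def)
qed

lemma max_ext_in_thompson_higman:
  assumes "finite A" "A \<noteq> {}" "right_ideal_iso A \<theta>" "contains_long A (dom \<theta>)" "contains_long A (ran \<theta>)"
  shows "max_ext A \<theta> \<in> carrier (thompson_higman A)"
proof -
  note m = right_ideal_iso_max_ext[OF assms(2-4)] le_max_ext[OF assms(2-4)] max_ext_greatest[OF assms(2-4)]
  have "\<psi> = max_ext A \<theta>" if "right_ideal_iso A \<psi>" "max_ext A \<theta> \<subseteq>\<^sub>m \<psi>" for \<psi>
    using m(3)[OF that(1)] m(2) that(2) map_le_antisym map_le_trans by blast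
  moreover have "contains_long A (dom (max_ext A \<theta>))" "contains_long A (ran (max_ext A \<theta>))"
    using contains_long_mono[OF assms(4) map_le_implies_dom_le] contains_long_mono[OF assms(5) ran_mono] m(2) by auto
  ultimately show ?thesis using m(1) by (simp add: carrier_thompson_higman[OF assms(1,2)])
qed

lemma thompson_higman_mult_closed:
  assumes "finite A" "A \<noteq> {}" "\<phi> \<in> carrier (thompson_higman A)" "\<psi> \<in> carrier (thompson_higman A)"
  shows "\<phi> \<otimes>\<^bsub>thompson_higman A\<^esub> \<psi> \<in> carrier (thompson_higman A)"
  using max_ext_in_thompson_higman[OF assms(1,2) right_ideal_iso_comp contains_long_dom_comp contains_long_ran_comp]
    assms(3,4) by (simp add: carrier_thompson_higman[OF assms(1,2)]) (simp add: thompson_higman_def)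

lemma thompson_higman_one_closed:
  assumes "finite A" "A \<noteq> {}"
  shows "Some |` lists A \<in> carrier (thompson_higman A)"
proof -
  have "\<psi> = Some |` lists A" if "right_ideal_iso A \<psi>" "Some |` lists A \<subseteq>\<^sub>m \<psi>" for \<psi>
  proof (rule map_le_antisym[OF _ that(2)])
    have "dom \<psi> \<subseteq> lists A" using right_ideal_iso_arg[OF that(1)] by auto
    then have "dom \<psi> \<subseteq> dom (Some |` lists A)" by simp
    then show "\<psi> \<subseteq>\<^sub>m Some |` lists A" using that(2) unfolding map_le_def by (metis subsetD)
  qed
  moreover have "right_ideal_iso A (Some |` lists A)"
    by (rule right_ideal_isoI) (auto simp: restrict_map_def split: if_splits)
  moreover have "dom (Some |` lists A) = lists A" "ran (Some |` lists A) = lists A"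
    by (auto simp: restrict_map_def ran_def dom_def)
  ultimately show ?thesis using assms by (auto simp: carrier_thompson_higman contains_long_def)
qed

text \<open>Maximality is inherited because an extension of the inverse inverts to an extension of
  \<open>\<phi>\<close>.\<close>

lemma thompson_higman_inverse_closed:
  assumes "finite A" "A \<noteq> {}" "\<phi> \<in> carrier (thompson_higman A)"
  shows "inverse_map \<phi> \<in> carrier (thompson_higman A)"
proof -
  have \<phi>: "right_ideal_iso A \<phi>" "contains_long A (dom \<phi>)" "contains_long A (ran \<phi>)"
    "\<And>\<psi>. right_ideal_iso A \<psi> \<Longrightarrow> \<phi> \<subseteq>\<^sub>m \<psi> \<Longrightarrow> \<psi> = \<phi>"
    using assms by (auto simp: carrier_thompson_higman)
  have "\<psi> = inverse_map \<phi>" if \<psi>: "right_ideal_iso A \<psi>" "inverse_map \<phi> \<subseteq>\<^sub>m \<psi>" for \<psi>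
  proof -
    have "\<phi> \<subseteq>\<^sub>m inverse_map \<psi>"
      using inverse_map_le[OF right_ideal_iso_inverse_map[OF \<phi>(1)] \<psi>] by (simp add: inverse_map_inverse_map[OF \<phi>(1)])
    then have "inverse_map \<psi> = \<phi>" using \<phi>(4) right_ideal_iso_inverse_map[OF \<psi>(1)] by blast
    then show ?thesis using inverse_map_inverse_map[OF \<psi>(1)] by simp
  qed
  then show ?thesis using \<phi> assms(1,2)
    by (simp add: carrier_thompson_higman right_ideal_iso_inverse_map dom_inverse_map ran_inverse_map)
qed

text \<open>The common restriction still has all long words in its domain, hence a maximum
  extension. Both maps lie below that extension, and by maximality both are equal to it.\<close>

lemma thompson_higman_eqI:
  assumes "finite A" "A \<noteq> {}" "\<phi> \<in> carrier (thompson_higman A)" "\<psi> \<in> carrier (thompson_higman A)"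
    and agree: "\<And>u. u \<in> dom \<phi> \<inter> dom \<psi> \<Longrightarrow> \<phi> u = \<psi> u"
  shows "\<phi> = \<psi>"
proof -
  have \<phi>: "right_ideal_iso A \<phi>" "contains_long A (dom \<phi>)" "\<And>\<chi>. right_ideal_iso A \<chi> \<Longrightarrow> \<phi> \<subseteq>\<^sub>m \<chi> \<Longrightarrow> \<chi> = \<phi>"
    and \<psi>: "right_ideal_iso A \<psi>" "contains_long A (dom \<psi>)" "\<And>\<chi>. right_ideal_iso A \<chi> \<Longrightarrow> \<psi> \<subseteq>\<^sub>m \<chi> \<Longrightarrow> \<chi> = \<psi>"
    using assms(1-4) by (auto simp: carrier_thompson_higman)
  define \<theta> where "\<theta> = \<phi> |` dom \<psi>"
  have \<theta>: "\<theta> u = Some v \<longleftrightarrow> \<phi> u = Some v \<and> \<psi> u = Some v" for u v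
    using agree[of u] by (cases "\<psi> u") (auto simp: \<theta>_def restrict_map_def dom_def)
  have dom: "dom \<theta> = dom \<phi> \<inter> dom \<psi>" by (auto simp: \<theta>_def)
  have "right_ideal_iso A \<theta>"
  proof (rule right_ideal_isoI)
    fix u v assume "\<theta> u = Some v"
    then have uv: "\<phi> u = Some v" "\<psi> u = Some v" by (simp_all add: \<theta>)
    show "u \<in> lists A" using \<phi>(1) uv(1) by (rule right_ideal_iso_arg)
    show "v \<in> lists A" using \<phi>(1) uv(1) by (rule right_ideal_iso_val)
    show "\<theta> (u @ x) = Some (v @ x)" if "x \<in> lists A" for x
      using right_ideal_iso_append[OF \<phi>(1) uv(1) that] right_ideal_iso_append[OF \<psi>(1) uv(2) that] by (simp add: \<theta>)
  next
    fix u u' v assume "\<theta> u = Some v" "\<theta> u' = Some v"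
    then show "u = u'" using right_ideal_iso_inj[OF \<phi>(1)] by (simp add: \<theta>)
  qed
  moreover have "contains_long A (dom \<theta>)" unfolding dom using \<phi>(2) \<psi>(2) by (rule contains_long_Int)
  moreover have "\<theta> \<subseteq>\<^sub>m \<phi>" "\<theta> \<subseteq>\<^sub>m \<psi>" unfolding map_le_def using \<theta> by (metis domD)+
  ultimately have "\<phi> \<subseteq>\<^sub>m max_ext A \<theta>" "\<psi> \<subseteq>\<^sub>m max_ext A \<theta>" "right_ideal_iso A (max_ext A \<theta>)"
    using max_ext_greatest[OF assms(2)] right_ideal_iso_max_ext[OF assms(2)] \<phi>(1) \<psi>(1) by auto
  then show ?thesis using \<phi>(3) \<psi>(3) by metis
qed

section \<open>Words in the generators\<close>

text \<open>The element \<open>u a\<close> stands for the adjoint of \<open>t a\<close>; these are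
  the Leavitt relations in a ring. Generators are indexed by the alphabet, so that words are lists
  over \<open>A\<close>.\<close>

locale cuntz_relations = ring R for R (structure) +
  fixes A :: "'l set" and t u :: "'l \<Rightarrow> 'a"
  assumes finite_A: "finite A" and card_A: "2 \<le> card A"
    and t_closed [simp]: "a \<in> A \<Longrightarrow> t a \<in> carrier R"
    and u_closed [simp]: "a \<in> A \<Longrightarrow> u a \<in> carrier R"
    and u_t: "a \<in> A \<Longrightarrow> b \<in> A \<Longrightarrow> u a \<otimes> t b = (if a = b then \<one> else \<zero>)"
    and sum_t_u: "(\<Oplus>a\<in>A. t a \<otimes> u a) = \<one>"
    and nontrivial: "\<one> \<noteq> \<zero>"
begin

lemma A_nonempty: "A \<noteq> {}"
  using card_A by auto

definition word :: "'l list \<Rightarrow> 'a" where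
  "word w = foldr (\<lambda>a x. t a \<otimes> x) w \<one>"

lemma word_simps [simp]: "word [] = \<one>" "word (a # w) = t a \<otimes> word w"
  by (simp_all add: word_def)

lemma word_closed [simp]: "w \<in> lists A \<Longrightarrow> word w \<in> carrier R"
  by (induction w) auto

lemma word_append: "v \<in> lists A \<Longrightarrow> w \<in> lists A \<Longrightarrow> word (v @ w) = word v \<otimes> word w"
  by (induction v) (auto simp: m_assoc simp del: in_lists_conv_set)

text \<open>This is the source of elements with prescribed products: right multiplication by
  \<open>t b\<close> extracts the coefficient at \<open>b\<close>.\<close>

lemma sum_u_mult_t:
  assumes "f \<in> A \<rightarrow> carrier R" "b \<in> A"
  shows "(\<Oplus>a\<in>A. f a \<otimes> u a) \<otimes> t b = f b"
proof -
  have "(\<Oplus>a\<in>A. f a \<otimes> u a) \<otimes> t b = (\<Oplus>a\<in>A. f a \<otimes> u a \<otimes> t b)"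
    using assms finite_A by (intro finsum_ldistr) (auto simp: Pi_def)
  also have "\<dots> = (\<Oplus>a\<in>A. if b = a then f a else \<zero>)"
  proof (rule finsum_cong')
    fix a assume "a \<in> A"
    then show "f a \<otimes> u a \<otimes> t b = (if b = a then f a else \<zero>)"
      using assms u_t[of a b] by (auto simp: m_assoc Pi_def)
  qed (use assms in auto)
  also have "\<dots> = f b" using add.finprod_singleton[OF assms(2) finite_A assms(1)] by simp
  finally show ?thesis .
qed

text \<open>Multiplying \<open>z\<close> by the sum that equals 1 recovers \<open>z\<close> from its
  products with the letters.\<close>

lemma cancel_letters:
  assumes "x \<in> carrier R" "y \<in> carrier R" "\<And>a. a \<in> A \<Longrightarrow> x \<otimes> t a = y \<otimes> t a"
  shows "x = y"
proof -
  have "z = (\<Oplus>a\<in>A. z \<otimes> t a \<otimes> u a)" if "z \<in> carrier R" for z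
  proof -
    have "z = z \<otimes> (\<Oplus>a\<in>A. t a \<otimes> u a)" using that by (simp add: sum_t_u)
    also have "\<dots> = (\<Oplus>a\<in>A. z \<otimes> (t a \<otimes> u a))"
      using that finite_A by (intro finsum_rdistr) (auto simp: Pi_def)
    also have "\<dots> = (\<Oplus>a\<in>A. z \<otimes> t a \<otimes> u a)"
      using that by (intro finsum_cong') (auto simp: m_assoc)
    finally show ?thesis .
  qed
  then have "x = (\<Oplus>a\<in>A. x \<otimes> t a \<otimes> u a)" "y = (\<Oplus>a\<in>A. y \<otimes> t a \<otimes> u a)" using assms by blast+
  moreover have "(\<Oplus>a\<in>A. x \<otimes> t a \<otimes> u a) = (\<Oplus>a\<in>A. y \<otimes> t a \<otimes> u a)"
    using assms by (intro finsum_cong') auto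
  ultimately show ?thesis by simp
qed

lemma cancel_words:
  assumes "x \<in> carrier R" "y \<in> carrier R"
    and "\<And>w. w \<in> lists A \<Longrightarrow> length w = N \<Longrightarrow> x \<otimes> word w = y \<otimes> word w"
  shows "x = y"
  using assms(3)
proof (induction N)
  case 0
  from 0[of "[]"] assms(1,2) show ?case by simp
next
  case (Suc N)
  have "x \<otimes> word w = y \<otimes> word w" if w: "w \<in> lists A" "length w = N" for w
  proof (rule cancel_letters)
    fix a assume "a \<in> A"
    then show "x \<otimes> word w \<otimes> t a = y \<otimes> word w \<otimes> t a"
      using Suc.prems[of "w @ [a]"] w assms(1,2) by (simp add: word_append m_assoc)
  qed (use w assms in auto)
  then show ?case by (rule Suc.IH)
qed

text \<open>The induction removes the last letter: the values at \<open>w @ [a]\<close> are packed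
  into a single value at \<open>w\<close>, from which multiplication by \<open>t a\<close> extracts
  them again.\<close>

lemma ex_prescribed_on_words:
  assumes "\<And>w. w \<in> lists A \<Longrightarrow> length w = N \<Longrightarrow> f w \<in> carrier R"
  shows "\<exists>x\<in>carrier R. \<forall>w\<in>lists A. length w = N \<longrightarrow> x \<otimes> word w = f w"
  using assms
proof (induction N arbitrary: f)
  case 0
  then show ?case by (intro bexI[of _ "f []"]) auto
next
  case (Suc N)
  define g where "g w = (\<Oplus>a\<in>A. f (w @ [a]) \<otimes> u a)" for w
  have f: "(\<lambda>a. f (w @ [a])) \<in> A \<rightarrow> carrier R" if "w \<in> lists A" "length w = N" for w
    using that by (auto intro!: Suc.prems)
  have "g w \<in> carrier R" if "w \<in> lists A" "length w = N" for w
    unfolding g_def using f[OF that] by (intro finsum_closed) (auto simp: Pi_def)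
  then obtain x where x: "x \<in> carrier R" "\<forall>w\<in>lists A. length w = N \<longrightarrow> x \<otimes> word w = g w"
    using Suc.IH[of g] by blast
  have "x \<otimes> word w = f w" if w: "w \<in> lists A" "length w = Suc N" for w
  proof -
    obtain v a where v: "w = v @ [a]" using w(2) by (metis length_Suc_conv_rev)
    then have va: "v \<in> lists A" "a \<in> A" "length v = N" using w by auto
    have "x \<otimes> word w = x \<otimes> word v \<otimes> t a" using v va x(1) by (simp add: word_append m_assoc)
    also have "\<dots> = f w" using x(2) va sum_u_mult_t[OF f[OF va(1,3)] va(2)] by (simp add: g_def v)
    finally show ?thesis .
  qed
  then show ?case using x(1) by blast
qed

lemma word_neq_zero: "w \<in> lists A \<Longrightarrow> word w \<noteq> \<zero>"
proof (induction w)
  case (Cons a w)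
  then have "u a \<otimes> word (a # w) = word w" by (simp flip: m_assoc add: u_t)
  then show ?case using Cons by auto
qed (use nontrivial in simp)

text \<open>Two letters are essential: for a single letter, \<open>t a = u a = \<one>\<close>
  satisfies the relations. A second letter \<open>b\<close> gives \<open>u b\<close>, which
  annihilates every word starting with \<open>a\<close> but is not 0 itself.\<close>

lemma word_Cons_neq_one:
  assumes "a \<in> A" "w \<in> lists A"
  shows "word (a # w) \<noteq> \<one>"
proof
  assume 1: "word (a # w) = \<one>"
  obtain b where b: "b \<in> A" "b \<noteq> a"
    using card_A by (metis One_nat_def Suc_1 card_le_Suc0_iff_eq finite_A not_less_eq_eq)
  have "u b = u b \<otimes> word (a # w)" using b 1 by simp
  also have "\<dots> = \<zero>" using b assms by (simp flip: m_assoc add: u_t)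
  finally show False using u_t[OF b(1) b(1)] b nontrivial by simp
qed

text \<open>Left multiplication by \<open>u a\<close> strips a common first letter, and turns one
  side into 0 if the first letters differ. Words of different length end in the comparison with the
  empty word.\<close>

lemma word_inj:
  assumes "v \<in> lists A" "w \<in> lists A" "word v = word w"
  shows "v = w"
  using assms
proof (induction v arbitrary: w rule: list.induct)
  case Nil
  show ?case
  proof (cases w)
    case (Cons a w')
    then show ?thesis using Nil.prems word_Cons_neq_one[of a w'] by auto
  qed simp
next
  case (Cons a v)
  show ?case
  proof (cases w)
    case Nil
    then show ?thesis using Cons.prems word_Cons_neq_one[of a v] by auto
  next
    case w: (Cons b w')
    have c: "a \<in> A" "b \<in> A" "v \<in> lists A" "w' \<in> lists A" using Cons.prems(1,2) w by auto
    have "u a \<otimes> (t a \<otimes> word v) = u a \<otimes> (t b \<otimes> word w')" using Cons.prems(3) unfolding w by simp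
    then have *: "word v = (if a = b then \<one> else \<zero>) \<otimes> word w'"
      using c by (simp flip: m_assoc add: u_t)
    show ?thesis
    proof (cases "a = b")
      case True
      then have "word v = word w'" using * c(4) by simp
      then have "v = w'" using c(3,4) by (intro Cons.IH)
      then show ?thesis using True w by simp
    next
      case False
      then have "word v = \<zero>" using * c(4) by simp
      then show ?thesis using word_neq_zero[OF c(3)] by contradiction
    qed
  qed
qed

section \<open>The representation of the Thompson--Higman group\<close>

definition implements :: "'a \<Rightarrow> ('l list \<rightharpoonup> 'l list) \<Rightarrow> bool" where
  "implements x \<phi> \<longleftrightarrow> x \<in> carrier R \<and> (\<forall>v w. \<phi> v = Some w \<longrightarrow> x \<otimes> word v = word w)"

lemma implements_mono: "implements x \<psi> \<Longrightarrow> \<phi> \<subseteq>\<^sub>m \<psi> \<Longrightarrow> implements x \<phi>"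
  unfolding implements_def map_le_def by (metis domI)

lemma implements_unique:
  assumes "contains_long A (dom \<phi>)" "implements x \<phi>" "implements y \<phi>"
  shows "x = y"
proof -
  obtain N where N: "\<forall>w\<in>lists A. N \<le> length w \<longrightarrow> w \<in> dom \<phi>"
    using assms(1) unfolding contains_long_def by blast
  show ?thesis
  proof (rule cancel_words[of x y N])
    fix w assume "w \<in> lists A" "length w = N"
    then obtain v where "\<phi> w = Some v" using N by auto
    then show "x \<otimes> word w = y \<otimes> word w" using assms(2,3) by (simp add: implements_def)
  qed (use assms(2,3) in \<open>auto simp: implements_def\<close>)
qed

text \<open>Prescribing \<open>x\<close> on words of length \<open>N\<close> determines it, but the
  domain may contain shorter words.\<close>

lemma ex_implements:
  assumes "right_ideal_iso A \<phi>" "contains_long A (dom \<phi>)"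
  shows "\<exists>x. implements x \<phi>"
proof -
  obtain N where N: "\<forall>w\<in>lists A. N \<le> length w \<longrightarrow> w \<in> dom \<phi>"
    using assms(2) unfolding contains_long_def by blast
  have "word (the (\<phi> w)) \<in> carrier R" if w: "w \<in> lists A" "length w = N" for w
  proof -
    obtain v where v: "\<phi> w = Some v" using N w by auto
    then show ?thesis using right_ideal_iso_val[OF assms(1) v] by simp
  qed
  then obtain x where x: "x \<in> carrier R" "\<forall>w\<in>lists A. length w = N \<longrightarrow> x \<otimes> word w = word (the (\<phi> w))"
    using ex_prescribed_on_words[of N "\<lambda>w. word (the (\<phi> w))"] by blast
  have "x \<otimes> word v = word w" if vw: "\<phi> v = Some w" for v w
  proof (rule cancel_words[of _ _ N])
    have c: "v \<in> lists A" "w \<in> lists A"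
      using right_ideal_iso_arg[OF assms(1) vw] right_ideal_iso_val[OF assms(1) vw] by auto
    then show "x \<otimes> word v \<in> carrier R" "word w \<in> carrier R" using x(1) by simp_all
    fix z assume z: "z \<in> lists A" "length z = N"
    \<comment> \<open>For such a word, \<open>v @ z\<close> is cut again after \<open>N\<close>
      letters. Compatibility of \<open>\<phi>\<close> with both factorizations gives the equality
      after multiplication by \<open>word z\<close>, and \<open>cancel_words\<close> removes this
      factor.\<close>
    have "v @ z \<in> lists A" "N \<le> length (v @ z)" using c z by auto
    then obtain p q where pq: "v @ z = p @ q" "p \<in> lists A" "q \<in> lists A" "length p = N"
      by (rule split_long_word)
    obtain p' where p': "\<phi> p = Some p'" using N pq by auto
    have "x \<otimes> word v \<otimes> word z = x \<otimes> word (p @ q)"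
      unfolding pq(1)[symmetric] using x(1) c z by (simp add: word_append m_assoc)
    also have "\<dots> = x \<otimes> word p \<otimes> word q" using x(1) pq by (simp add: word_append m_assoc)
    also have "\<dots> = word p' \<otimes> word q" using x(2) pq p' by simp
    also have "\<dots> = word (p' @ q)" using right_ideal_iso_val[OF assms(1) p'] pq by (simp add: word_append)
    also have "p' @ q = w @ z"
      using right_ideal_iso_append[OF assms(1) p' pq(3)] right_ideal_iso_append[OF assms(1) vw z(1)] pq(1) by simp
    also have "word (w @ z) = word w \<otimes> word z" using c z by (simp add: word_append)
    finally show "x \<otimes> word v \<otimes> word z = word w \<otimes> word z" .
  qed
  then show ?thesis using x(1) by (auto simp: implements_def)
qed

lemma implements_comp:
  assumes "implements x \<phi>" "implements y \<psi>" "right_ideal_iso A \<psi>"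
  shows "implements (x \<otimes> y) (\<phi> \<circ>\<^sub>m \<psi>)"
  using assms right_ideal_iso_arg[OF assms(3)]
  by (auto simp: implements_def map_comp_Some_iff m_assoc simp del: in_lists_conv_set)

definition rep :: "('l list \<rightharpoonup> 'l list) \<Rightarrow> 'a" where
  "rep \<phi> = (THE x. implements x \<phi>)"

abbreviation G where "G \<equiv> thompson_higman A"

lemmas carrier_G = carrier_thompson_higman[OF finite_A A_nonempty]

lemma implements_rep: "\<phi> \<in> carrier G \<Longrightarrow> implements (rep \<phi>) \<phi>"
  unfolding rep_def carrier_G using ex_implements implements_unique by (metis the_equality)

text \<open>Any restriction that keeps the long words already determines \<open>rep \<phi>\<close>.
  This is what makes \<open>rep\<close> blind to the passage from a composite to its maximum
  extension.\<close>

lemma rep_eqI: "\<phi> \<in> carrier G \<Longrightarrow> contains_long A (dom \<theta>) \<Longrightarrow> \<theta> \<subseteq>\<^sub>m \<phi> \<Longrightarrow> implements x \<theta> \<Longrightarrow> rep \<phi> = x"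
  using implements_rep implements_mono implements_unique by metis

lemma rep_closed: "\<phi> \<in> carrier G \<Longrightarrow> rep \<phi> \<in> carrier R"
  using implements_rep by (simp add: implements_def)

lemma rep_mult:
  assumes "\<phi> \<in> carrier G" "\<psi> \<in> carrier G"
  shows "rep (\<phi> \<otimes>\<^bsub>G\<^esub> \<psi>) = rep \<phi> \<otimes> rep \<psi>"
proof (rule rep_eqI)
  have *: "right_ideal_iso A \<phi>" "right_ideal_iso A \<psi>" "contains_long A (dom \<phi>)" "contains_long A (dom \<psi>)"
    using assms by (auto simp: carrier_G)
  show "\<phi> \<otimes>\<^bsub>G\<^esub> \<psi> \<in> carrier G" using thompson_higman_mult_closed[OF finite_A A_nonempty assms] .
  show long: "contains_long A (dom (\<phi> \<circ>\<^sub>m \<psi>))" using * by (rule contains_long_dom_comp)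
  show "\<phi> \<circ>\<^sub>m \<psi> \<subseteq>\<^sub>m \<phi> \<otimes>\<^bsub>G\<^esub> \<psi>"
    using le_max_ext[OF A_nonempty right_ideal_iso_comp[OF *(1,2)] long] by (simp add: thompson_higman_def)
  show "implements (rep \<phi> \<otimes> rep \<psi>) (\<phi> \<circ>\<^sub>m \<psi>)"
    using implements_comp implements_rep assms *(2) by blast
qed

lemma rep_one: "rep (Some |` lists A) = \<one>"
  by (rule rep_eqI[OF thompson_higman_one_closed[OF finite_A A_nonempty], of "Some |` lists A"])
     (auto simp: implements_def restrict_map_def contains_long_def dom_def simp del: in_lists_conv_set
       split: if_splits)

text \<open>The composite is the identity on the domain of \<open>\<phi>\<close>, which is
  implemented by \<open>\<one>\<close> as well. A left inverse is what \<open>groupI\<close> asks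
  for.\<close>

lemma rep_inverse:
  assumes "\<phi> \<in> carrier G"
  shows "rep (inverse_map \<phi>) \<otimes> rep \<phi> = \<one>"
proof (rule implements_unique)
  have \<phi>: "right_ideal_iso A \<phi>" "contains_long A (dom \<phi>)" using assms by (auto simp: carrier_G)
  have inv: "inverse_map \<phi> \<circ>\<^sub>m \<phi> = Some |` dom \<phi>"
    by (rule ext) (auto simp: map_comp_def restrict_map_def inverse_map_eq_Some_iff[OF \<phi>(1)] split: option.splits)
  have "dom (Some |` dom \<phi>) = dom \<phi>" by (auto simp: restrict_map_def dom_def)
  then show "contains_long A (dom (Some |` dom \<phi>))" using \<phi>(2) by simp
  show "implements (rep (inverse_map \<phi>) \<otimes> rep \<phi>) (Some |` dom \<phi>)"
    using implements_comp[OF implements_rep implements_rep \<phi>(1),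
        OF thompson_higman_inverse_closed[OF finite_A A_nonempty assms] assms] by (simp only: inv)
  show "implements \<one> (Some |` dom \<phi>)"
    using right_ideal_iso_arg[OF \<phi>(1)] by (auto simp: implements_def restrict_map_def simp del: in_lists_conv_set split: if_splits)
qed

text \<open>On the common domain the two values have the same product of generators, so they
  coincide by \<open>word_inj\<close>; maximality extends this to equality of the maps.\<close>

lemma rep_inj: "inj_on rep (carrier G)"
proof (rule inj_onI)
  fix \<phi> \<psi> assume *: "\<phi> \<in> carrier G" "\<psi> \<in> carrier G" "rep \<phi> = rep \<psi>"
  show "\<phi> = \<psi>"
  proof (rule thompson_higman_eqI[OF finite_A A_nonempty *(1,2)])
    fix v assume "v \<in> dom \<phi> \<inter> dom \<psi>"
    then obtain w w' where w: "\<phi> v = Some w" "\<psi> v = Some w'" by auto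
    have "right_ideal_iso A \<phi>" "right_ideal_iso A \<psi>" using * by (auto simp: carrier_G)
    then have "w \<in> lists A" "w' \<in> lists A" using w right_ideal_iso_val by metis+
    moreover have "word w = word w'"
      using implements_rep[OF *(1)] implements_rep[OF *(2)] w *(3) unfolding implements_def by metis
    ultimately show "\<phi> v = \<psi> v" using w word_inj by metis
  qed
qed

end

text \<open>The bijection \<open>g\<close> translates between letters of an arbitrary type and the
  numbering of the generators.\<close>

lemma cuntz_algebra_relations:
  assumes "cuntz_algebra n M s" "2 \<le> n" "bij_betw g A {1..n}"
  shows "cuntz_relations M A (s \<circ> g) (\<lambda>a. adj\<^bsub>M\<^esub> (s (g a)))"
proof -
  have fam: "cuntz_family n M s" and "unital_cstar_algebra M" using assms(1) by (auto simp: cuntz_algebra_def)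
  then interpret unital_cstar_algebra M by simp
  have g: "g a \<in> {1..n}" if "a \<in> A" for a using assms(3) that by (auto simp: bij_betw_def)
  have inj: "inj_on g A" and img: "g ` A = {1..n}" using assms(3) by (auto simp: bij_betw_def)
  have s: "s i \<in> carrier M" if "i \<in> {1..n}" for i using fam that by (auto simp: cuntz_family_def)
  show ?thesis
  proof (unfold_locales)
    show "finite A" using bij_betw_finite[OF assms(3)] by simp
    show "2 \<le> card A" using bij_betw_same_card[OF assms(3)] assms(2) by simp
    show "(s \<circ> g) a \<in> carrier M" if "a \<in> A" for a using s[OF g[OF that]] by simp
    show "adj\<^bsub>M\<^esub> (s (g a)) \<in> carrier M" if "a \<in> A" for a using s[OF g[OF that]] by (rule adj_closed)
    show "adj\<^bsub>M\<^esub> (s (g a)) \<otimes>\<^bsub>M\<^esub> (s \<circ> g) b = (if a = b then \<one>\<^bsub>M\<^esub> else \<zero>\<^bsub>M\<^esub>)" if "a \<in> A" "b \<in> A" for a b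
      using fam g[OF that(1)] g[OF that(2)] inj that unfolding cuntz_family_def inj_on_def o_def by metis
    have "(\<Oplus>\<^bsub>M\<^esub>i\<in>g ` A. s i \<otimes>\<^bsub>M\<^esub> adj\<^bsub>M\<^esub> (s i)) = (\<Oplus>\<^bsub>M\<^esub>a\<in>A. s (g a) \<otimes>\<^bsub>M\<^esub> adj\<^bsub>M\<^esub> (s (g a)))"
      by (rule finsum_reindex[OF _ inj]) (auto simp: img s adj_closed)
    then show "(\<Oplus>\<^bsub>M\<^esub>a\<in>A. (s \<circ> g) a \<otimes>\<^bsub>M\<^esub> adj\<^bsub>M\<^esub> (s (g a))) = \<one>\<^bsub>M\<^esub>"
      using fam by (simp add: img cuntz_family_def)
    show "\<one>\<^bsub>M\<^esub> \<noteq> \<zero>\<^bsub>M\<^esub>" using cuntz_algebra_nontrivial[OF assms(1)] assms(2) by simp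
  qed
qed

text \<open>The image of \<open>rep\<close> is a submonoid with left inverses, hence a group. The
  isomorphism is then just a multiplicative bijection onto it.\<close>

lemma thompson_higman_embeds:
  assumes "cuntz_algebra (card A) M s" "2 \<le> card A"
  shows "\<exists>H. subgroup_of_monoid H (multiplicative_part M) \<and>
    thompson_higman A \<cong> (multiplicative_part M)\<lparr>carrier := H\<rparr>"
proof -
  have "finite A" using assms(2) by (intro card_ge_0_finite) simp
  then obtain g where "bij_betw g A {1..card A}"
    using finite_same_card_bij[of A "{1..card A}"] by auto
  then interpret cuntz_relations M A "s \<circ> g" "\<lambda>a. adj\<^bsub>M\<^esub> (s (g a))"
    using assms by (intro cuntz_algebra_relations)
  let ?H = "rep ` carrier G"
  have closed: "x \<otimes>\<^bsub>M\<^esub> y \<in> ?H" if xy: "x \<in> ?H" "y \<in> ?H" for x y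
  proof -
    obtain \<phi> \<psi> where *: "\<phi> \<in> carrier G" "\<psi> \<in> carrier G" "x = rep \<phi>" "y = rep \<psi>" using xy by blast
    then show ?thesis
      using rep_mult thompson_higman_mult_closed[OF finite_A A_nonempty *(1,2)] by (metis image_eqI)
  qed
  have one: "\<one>\<^bsub>M\<^esub> \<in> ?H"
    using rep_one thompson_higman_one_closed[OF finite_A A_nonempty] by (metis image_eqI)
  have inverse: "\<exists>y\<in>?H. y \<otimes>\<^bsub>M\<^esub> x = \<one>\<^bsub>M\<^esub>" if "x \<in> ?H" for x
    using that rep_inverse thompson_higman_inverse_closed[OF finite_A A_nonempty] by blast
  have sub: "?H \<subseteq> carrier M" using rep_closed by blast
  have "submonoid ?H (multiplicative_part M)"
    by (rule submonoid.intro) (use sub closed one in \<open>auto simp: multiplicative_part_def\<close>)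
  moreover have "group ((multiplicative_part M)\<lparr>carrier := ?H\<rparr>)"
    by (rule groupI) (use sub closed one inverse in \<open>auto simp: multiplicative_part_def m_assoc subset_iff\<close>)
  moreover have "rep \<in> iso G ((multiplicative_part M)\<lparr>carrier := ?H\<rparr>)"
    using rep_mult rep_inj by (auto simp: iso_def hom_def bij_betw_def multiplicative_part_def)
  ultimately show ?thesis unfolding subgroup_of_monoid_def is_iso_def by blast
qed

theorem corollary7p4:
  shows "(\<forall>(O2 :: 'b cstar) s. cuntz_algebra 2 O2 s \<longrightarrow>
            (\<exists>H. subgroup_of_monoid H (multiplicative_part O2) \<and>
                 thompson_V \<cong> (multiplicative_part O2)\<lparr>carrier := H\<rparr>)) \<and>
         (\<forall>n\<ge>2. \<forall>(A :: 'a set) (On :: 'b cstar) s. card A = n \<and> cuntz_algebra n On s \<longrightarrow>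
            (\<exists>H. subgroup_of_monoid H (multiplicative_part On) \<and>
                 thompson_higman A \<cong> (multiplicative_part On)\<lparr>carrier := H\<rparr>))"
proof (intro conjI allI impI)
  fix O2 :: "'b cstar" and s
  assume "cuntz_algebra 2 O2 s"
  then show "\<exists>H. subgroup_of_monoid H (multiplicative_part O2) \<and>
      thompson_V \<cong> (multiplicative_part O2)\<lparr>carrier := H\<rparr>"
    unfolding thompson_V_def by (intro thompson_higman_embeds[where s = s]) (simp_all add: numeral_2_eq_2)
next
  fix n and A :: "'a set" and On :: "'b cstar" and s
  assume "2 \<le> n" "card A = n \<and> cuntz_algebra n On s"
  then show "\<exists>H. subgroup_of_monoid H (multiplicative_part On) \<and>
      thompson_higman A \<cong> (multiplicative_part On)\<lparr>carrier := H\<rparr>"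
    by (intro thompson_higman_embeds[where s = s]) simp_all
qed

end
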